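(* Let $0<|q|<1$, let $k$ be a non-zero complex number, and let $(\alpha_n(a,k,q),\beta_n(a,k,q))$ be a WP-Bailey pair. Assume that none of the denominators below vanish and that all the series below converge. Then $$ \begin{aligned} &\sum_{n=1}^\infty\frac{(1-kq^{2n})(q;q)_{n-1}\left(\frac{k^2}{q};q\right)_n(q^2;q^2)_n}{(1-k)\left(\frac{q^2}{k},kq;q\right)_n(k^2;q^2)_n}\left(\frac{-q^2}{k}\right)^n\beta_n(q,k,q)\\ &\quad-\sum_{n=1}^\infty\frac{(q^2;q^2)_{n-1}\left(\frac{k^2}{q};q^2\right)_n q^{4n}\,\alpha_{2n}(q,k,q)}{\left(\frac{q^4}{k^2},q^3;q^2\right)_n k^{2n}} +\frac{(k^2-q)(k-q^2)}{(1-k)(1-q)(k^2-q^2)}\\ &=k\,\frac{(k^2q,\,q/k^2,\,q^2,\,q^2;q^2)_\infty}{(k^2,\,q^2/k^2,\,q,\,q;q^2)_\infty}\left(1+\sum_{n=0}^\infty\frac{\left(\frac{k^2}{q^2},\frac1q;q^2\right)_{n+1}q^{4n+4}\,\alpha_{2n+1}(q,k,q)}{\left(\frac{q^3}{k^2},q^2;q^2\right)_{n+1}k^{2n+2}}\right). \end{aligned} $$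
   Context: Notation: $(x;q)_0=1$, $(x;q)_n=\prod_{i=0}^{n-1}(1-xq^i)$, $(x;q)_\infty=\prod_{i\ge 0}(1-xq^i)$ for $|q|<1$, and $(x_1,\dots,x_r;q)_n=\prod_{i=1}^r(x_i;q)_n$ (also for $n=\infty$). A WP-Bailey pair is a pair of sequences $(\alpha_n(a,k,q),\beta_n(a,k,q))_{n\ge0}$ with $\alpha_0=\beta_0=1$ and, for $n>0$, $$\beta_n(a,k,q)=\sum_{j=0}^n\frac{(k/a;q)_{n-j}(k;q)_{n+j}}{(q;q)_{n-j}(aq;q)_{n+j}}\,\alpha_j(a,k,q).$$ Here the pair is used at $a=q$. *)

theory Defs
  imports "HOL-Analysis.Analysis"
begin

definition qpoch :: "complex \<Rightarrow> complex \<Rightarrow> nat \<Rightarrow> complex" where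
  "qpoch x q n = (\<Prod>i<n. 1 - x * q ^ i)"

definition qpoch_inf :: "complex \<Rightarrow> complex \<Rightarrow> complex" where
  "qpoch_inf x q = (\<Prod>i. 1 - x * q ^ i)"

definition qpochs :: "complex list \<Rightarrow> complex \<Rightarrow> nat \<Rightarrow> complex" where
  "qpochs xs q n = (\<Prod>x\<leftarrow>xs. qpoch x q n)"

definition qpochs_inf :: "complex list \<Rightarrow> complex \<Rightarrow> complex" where
  "qpochs_inf xs q = (\<Prod>x\<leftarrow>xs. qpoch_inf x q)"

text \<open>The sequences \<open>\<alpha>\<close> and \<open>\<beta>\<close> are the values at one fixed
  triple \<open>(a, k, q)\<close>.\<close>

definition WP_Bailey_pair ::
  "complex \<Rightarrow> complex \<Rightarrow> complex \<Rightarrow> (nat \<Rightarrow> complex) \<Rightarrow> (nat \<Rightarrow> complex) \<Rightarrow> bool" where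
  "WP_Bailey_pair a k q \<alpha> \<beta> \<longleftrightarrow>
     \<alpha> 0 = 1 \<and> \<beta> 0 = 1 \<and>
     (\<forall>n>0. \<beta> n = (\<Sum>j=0..n.
        qpoch (k / a) q (n - j) * qpoch k q (n + j) /
        (qpoch q q (n - j) * qpoch (a * q) q (n + j)) * \<alpha> j))"

end

theory Submission
  imports Defs "HOL-Complex_Analysis.Complex_Analysis"
begin

text \<open>Write the pair relation as \<open>\<beta> = M \<alpha>\<close> with the triangular matrix \<open>M\<close> and the claim as
  \<open>\<Sum>n. c n * \<beta> n = \<Sum>j. w j * \<alpha> j\<close>. For \<open>\<bar>q\<^sup>2\<bar> < \<bar>k\<bar>\<close> the column sums \<open>W j = \<Sum>n. c n * M n j\<close>
  converge, and creative telescoping shows that \<open>W (j + 2) / W j\<close> is the same rational function of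
  \<open>q\<^sup>j\<close> for both parities of \<open>j\<close>. The boundary terms of the telescoping give the even \<open>W j\<close> in
  closed form; the odd ones are then determined by comparing the common limit of
  \<open>W j / (- q\<^sup>2 / k) ^ j\<close> along even and odd \<open>j\<close>, which is where the infinite products come from.

  Only the three series of the theorem are assumed to converge, so the order of summation cannot be
  interchanged directly. Inverting \<open>M\<close> turns \<open>W = w\<close> into \<open>\<Sum>j. w j * inverse(M) j i = c i\<close>, a
  series that converges geometrically for every \<open>k\<close>. It is proved for \<open>\<bar>q\<bar> < \<bar>k\<bar>\<close> and extends by
  analytic continuation to all \<open>k\<close> for which \<open>k\<^sup>2\<close> is not an integral power of \<open>q\<close>. Its tails are
  small enough that \<open>c n * \<beta> n \<longlonglongrightarrow> 0\<close> suffices to compare the partial sums. In the remaining case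
  \<open>k\<^sup>2 = q ^ (1 - 2 * l)\<close> all but finitely many \<open>c n\<close> vanish.\<close>

section \<open>Preliminaries\<close>

text \<open>Sizes in \<open>k\<close> shape the argument. Up to bounded factors \<open>c n\<close>
  is \<open>(q^2/k)^n\<close>, \<open>w j\<close> is \<open>(q^2/k)^j\<close> and
  \<open>inverse(M) j i\<close> is \<open>(k/q)^(j-i)\<close>. For generic \<open>k\<close> with |k|
  <= |q^2| the sums \<open>W j\<close> diverge, so \<open>W = w\<close> has no meaning there. In
  \<open>w j * inverse(M) j i\<close>, of size \<open>(q/k)^i * q^j\<close>, the growth in
  \<open>k\<close> has cancelled: the inverted relation converges everywhere and is the form that
  can be continued. Its tail beyond \<open>N\<close> is of size \<open>(q^2/k)^i * q^(N-i)\<close>,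
  so the difference of the partial sums is bounded by a convolution of
  \<open>|\<beta> i| * |q^2/k|^i\<close> with a geometric sequence. That factor tends to
  \<open>0\<close> because \<open>c n * \<beta> n\<close> does and \<open>c n / (q^2/k)^n\<close>
  stays away from \<open>0\<close>. The last point fails exactly when \<open>k^2 = q^(1-2l)\<close>,
  where \<open>c n\<close> vanishes eventually; then |k| > |q^2|, and \<open>W = w\<close> is itself
  available as a family of finite sums.\<close>

lemma eq_times_divideI: "x * d = y * n \<Longrightarrow> d \<noteq> 0 \<Longrightarrow> x = y * (n / d)" for x :: complex
  by (simp add: field_simps)

lemma eq_times_divideI2:
  fixes x :: complex
  assumes "y * (a * b) = z * (c * d)" "x * (a' * b') = y * (c' * d')"
    and "a \<noteq> 0" "b \<noteq> 0" "a' \<noteq> 0" "b' \<noteq> 0"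
  shows "x = z * (c * c' * d * d' / (a * a' * b * b'))"
  by (rule eq_times_divideI) (use assms in algebra, use assms in simp)

text \<open>The terms below \<open>n0\<close> vanish, so the antidifference \<open>G\<close> leaves
  only its boundary value at \<open>n0\<close>. The sequences \<open>s\<close> and \<open>t\<close>
  will be two columns of \<open>bailey_term\<close>, with \<open>n0 = j\<close>, or
  \<open>n0 = 1\<close> when \<open>t\<close> is column \<open>0\<close>.\<close>

lemma suminf_telescope:
  fixes s t G :: "nat \<Rightarrow> complex"
  assumes "summable s" "summable t" "G \<longlonglongrightarrow> 0"
    and step: "\<And>n. n \<ge> n0 \<Longrightarrow> s n - R * t n = G (Suc n) - G n"
    and zero: "\<And>n. n < n0 \<Longrightarrow> s n = 0 \<and> t n = 0"
  shows "suminf s = R * suminf t - G n0"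
proof -
  have sm: "summable (\<lambda>n. s n - R * t n)"
    using assms by (intro summable_diff summable_mult)
  have "(\<lambda>n. G (n + n0)) \<longlonglongrightarrow> 0"
    using assms(3) by (rule LIMSEQ_ignore_initial_segment)
  then have "(\<lambda>n. G (Suc n + n0) - G (n + n0)) sums (0 - G (0 + n0))"
    by (rule telescope_sums)
  then have "(\<lambda>n. s (n + n0) - R * t (n + n0)) sums (- G n0)"
    using step by simp
  then have "(\<Sum>n. s n - R * t n) = - G n0"
    using suminf_split_initial_segment[OF sm, of n0] zero by (simp add: sums_iff)
  moreover have "(\<Sum>n. s n - R * t n) = suminf s - R * suminf t"
    using assms by (simp add: suminf_diff[symmetric] suminf_mult summable_mult)
  ultimately show ?thesis by (simp add: algebra_simps)
qed

text \<open>Read backwards from \<open>i = N\<close>, the summand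
  \<open>e (N - m) * \<rho> ^ m\<close> tends to \<open>0\<close> for each fixed \<open>m\<close>
  and is dominated by a multiple of \<open>\<rho> ^ m\<close>, so Tannery's theorem applies.\<close>

lemma tendsto_0_geometric_convolution:
  fixes e :: "nat \<Rightarrow> real"
  assumes e: "e \<longlonglongrightarrow> 0" and \<rho>: "0 \<le> \<rho>" "\<rho> < 1"
  shows "(\<lambda>N. \<Sum>i\<le>N. e i * \<rho> ^ (N - i)) \<longlonglongrightarrow> 0"
proof -
  obtain B where B: "\<And>n. norm (e n) \<le> B"
    using convergent_imp_bounded[OF e] by (auto simp: bounded_iff)
  define a where "a m N = (if m \<le> N then e (N - m) * \<rho> ^ m else 0)" for m N
  have lim: "(\<lambda>N. a m N) \<longlonglongrightarrow> 0" for m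
  proof -
    have "(\<lambda>N. a m (N + m)) \<longlonglongrightarrow> 0 * \<rho> ^ m"
      unfolding a_def using tendsto_mult[OF e tendsto_const] by simp
    then show ?thesis
      by (simp add: LIMSEQ_offset)
  qed
  have bound: "norm (a m N) \<le> B * \<rho> ^ m" for m N
    using B[of "N - m"] order_trans[OF norm_ge_zero B[of 0]] \<rho>
    by (auto simp: a_def abs_mult intro!: mult_right_mono)
  have "(\<lambda>N. \<Sum>m. a m N) \<longlonglongrightarrow> (\<Sum>m. 0 :: real)"
    by (rule conjunct2[OF conjunct2[OF tannerys_theorem[where M = "\<lambda>m. B * \<rho> ^ m"]]])
       (use lim bound \<rho> in \<open>auto intro!: summable_mult summable_geometric always_eventually\<close>)
  moreover have "(\<Sum>m. a m N) = (\<Sum>i\<le>N. e i * \<rho> ^ (N - i))" for N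
  proof -
    have "(\<Sum>m. a m N) = (\<Sum>m\<le>N. a m N)"
      by (rule suminf_finite) (auto simp: a_def)
    also have "\<dots> = (\<Sum>i\<le>N. a (N - i) N)"
      by (rule sum.reindex_bij_witness[of _ "\<lambda>i. N - i" "\<lambda>i. N - i"]) auto
    also have "\<dots> = (\<Sum>i\<le>N. e i * \<rho> ^ (N - i))"
      by (intro sum.cong refl) (simp add: a_def)
    finally show ?thesis .
  qed
  ultimately show ?thesis by simp
qed

lemma bounded_continuous_image:
  assumes "compact K" "continuous_on K f"
  shows "bounded (f ` K)"
  using assms compact_continuous_image compact_imp_bounded by blast

lemma countable_power2_eq: "countable {k :: complex. k\<^sup>2 = c}"
proof -
  have "k = csqrt c \<or> k = - csqrt c" if "k\<^sup>2 = c" for k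
    using that power2_csqrt[of c] power2_eq_iff by metis
  then have "{k :: complex. k\<^sup>2 = c} \<subseteq> {csqrt c, - csqrt c}" by blast
  then show ?thesis
    by (meson countable_finite finite.emptyI finite_insert finite_subset)
qed

lemma bounded_image_mult:
  fixes f g :: "'a \<Rightarrow> 'b::real_normed_algebra"
  assumes "bounded (f ` A)" "bounded (g ` A)"
  shows "bounded ((\<lambda>x. f x * g x) ` A)"
proof -
  obtain b c where b: "\<And>x. x \<in> A \<Longrightarrow> norm (f x) \<le> b" and c: "\<And>x. x \<in> A \<Longrightarrow> norm (g x) \<le> c"
    using assms by (auto simp: bounded_iff)
  have "norm (f x * g x) \<le> b * c" if "x \<in> A" for x
  proof -
    have "norm (f x * g x) \<le> norm (f x) * norm (g x)"
      by (rule norm_mult_ineq)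
    also have "\<dots> \<le> b * c"
      using b[OF that] c[OF that] norm_ge_zero[of "f x"] norm_ge_zero[of "g x"]
      by (intro mult_mono) linarith+
    finally show ?thesis .
  qed
  then show ?thesis by (auto simp: bounded_iff)
qed

text \<open>From \<open>1 + x \<le> exp x\<close> and the geometric series. The bound is independent
  of \<open>n\<close>; it serves both \<open>(x;q)_n\<close> and its reciprocal.\<close>

lemma norm_prod_le_exp:
  fixes f :: "nat \<Rightarrow> complex" and q :: real
  assumes "\<And>i. norm (f i) \<le> 1 + c * q ^ i" "0 \<le> q" "q < 1" "0 \<le> c"
  shows "norm (\<Prod>i<n. f i) \<le> exp (c / (1 - q))"
proof -
  have "norm (\<Prod>i<n. f i) = (\<Prod>i<n. norm (f i))"
    by (simp add: prod_norm)
  also have "\<dots> \<le> (\<Prod>i<n. exp (c * q ^ i))"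
    using assms by (intro prod_mono) (auto intro!: order_trans[OF assms(1)])
  also have "\<dots> = exp (c * (\<Sum>i<n. q ^ i))"
    by (simp add: exp_sum sum_distrib_left)
  also have "\<dots> \<le> exp (c / (1 - q))"
  proof -
    have "(\<Sum>i<n. q ^ i) \<le> (\<Sum>i. q ^ i)"
      using assms by (intro sum_le_suminf summable_geometric) auto
    also have "\<dots> = 1 / (1 - q)"
      using assms by (simp add: suminf_geometric)
    finally show ?thesis
      using mult_left_mono[of "\<Sum>i<n. q ^ i" "1 / (1 - q)" c] assms(4) by simp
  qed
  finally show ?thesis .
qed

section \<open>The q-Pochhammer symbol\<close>

lemma qpoch_0 [simp]: "qpoch x q 0 = 1"
  by (simp add: qpoch_def)

lemma qpoch_Suc: "qpoch x q (Suc n) = qpoch x q n * (1 - x * q ^ n)"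
  by (simp add: qpoch_def)

lemma qpoch_Suc_shift: "qpoch x q (Suc n) = (1 - x) * qpoch (x * q) q n"
  unfolding qpoch_def by (subst prod.lessThan_Suc_shift) (simp add: mult_ac)

lemma qpoch_add: "qpoch x q (m + n) = qpoch x q m * qpoch (x * q ^ m) q n"
  by (induction n) (simp_all add: qpoch_Suc power_add mult_ac)

lemma qpoch_eq_0_iff: "qpoch x q n = 0 \<longleftrightarrow> (\<exists>i<n. x * q ^ i = 1)"
  by (auto simp: qpoch_def)

lemma convergent_prod_qpoch:
  fixes x q :: complex
  assumes "norm q < 1"
  shows "convergent_prod (\<lambda>i. 1 - x * q ^ i)"
proof -
  have "summable (\<lambda>i. norm (1 - x * q ^ i - 1))"
    using summable_mult[OF summable_geometric[of "norm q"], of "norm x"] assms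
    by (simp add: norm_mult norm_power)
  then show ?thesis
    by (intro abs_convergent_prod_imp_convergent_prod)
       (simp add: abs_convergent_prod_conv_summable)
qed

lemma qpoch_LIMSEQ:
  assumes "norm q < 1"
  shows "qpoch x q \<longlonglongrightarrow> qpoch_inf x q"
proof -
  have "(\<lambda>n. \<Prod>i\<le>n. 1 - x * q ^ i) \<longlonglongrightarrow> qpoch_inf x q"
    unfolding qpoch_inf_def by (rule convergent_prod_LIMSEQ[OF convergent_prod_qpoch[OF assms]])
  then have "(\<lambda>n. qpoch x q (Suc n)) \<longlonglongrightarrow> qpoch_inf x q"
    by (simp add: qpoch_def lessThan_Suc_atMost)
  then show ?thesis
    by (simp only: filterlim_sequentially_Suc)
qed

lemma qpoch_inf_nonzero:
  assumes "norm q < 1" "\<And>i. x * q ^ i \<noteq> 1"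
  shows "qpoch_inf x q \<noteq> 0"
  unfolding qpoch_inf_def using assms
  by (intro prodinf_nonzero convergent_prod_qpoch) auto

lemma qpoch_inf_shift:
  assumes "norm q < 1"
  shows "qpoch_inf x q = (1 - x) * qpoch_inf (x * q) q"
proof -
  have "(\<lambda>n. qpoch x q (Suc n)) \<longlonglongrightarrow> (1 - x) * qpoch_inf (x * q) q"
    unfolding qpoch_Suc_shift by (intro tendsto_intros qpoch_LIMSEQ assms)
  moreover have "(\<lambda>n. qpoch x q (Suc n)) \<longlonglongrightarrow> qpoch_inf x q"
    using qpoch_LIMSEQ[OF assms] by (simp only: filterlim_sequentially_Suc)
  ultimately show ?thesis
    by (rule LIMSEQ_unique[symmetric])
qed

lemma qpoch_inf_eq_0_iff:
  assumes "norm q < 1"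
  shows "qpoch_inf x q = 0 \<longleftrightarrow> (\<exists>i. x * q ^ i = 1)"
proof
  assume "\<exists>i. x * q ^ i = 1"
  then obtain i where i: "x * q ^ i = 1" by blast
  have "qpoch x q n = 0" if "n > i" for n
    using i that by (auto simp: qpoch_eq_0_iff)
  then have "eventually (\<lambda>n. qpoch x q n = 0) sequentially"
    by (auto simp: eventually_sequentially intro!: exI[of _ "Suc i"])
  then have "qpoch x q \<longlonglongrightarrow> 0"
    by (rule tendsto_eventually)
  with qpoch_LIMSEQ[OF assms] show "qpoch_inf x q = 0"
    by (rule LIMSEQ_unique)
qed (use qpoch_inf_nonzero[OF assms] in blast)

lemma norm_qpoch_le:
  assumes "norm q < 1"
  shows "norm (qpoch x q n) \<le> exp (norm x / (1 - norm q))"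
  unfolding qpoch_def
proof (rule norm_prod_le_exp)
  show "norm (1 - x * q ^ i) \<le> 1 + norm x * norm q ^ i" for i
    using norm_triangle_ineq4[of 1 "x * q ^ i"] by (simp add: norm_mult norm_power)
qed (use assms in auto)

lemma norm_inverse_qpoch_le:
  assumes "norm q < 1" "norm x \<le> 1 / 2"
  shows "norm (inverse (qpoch x q n)) \<le> exp (2 * norm x / (1 - norm q))"
proof -
  have "norm (\<Prod>i<n. inverse (1 - x * q ^ i)) \<le> exp (2 * norm x / (1 - norm q))"
  proof (rule norm_prod_le_exp)
    fix i
    define y where "y = norm x * norm q ^ i"
    have y: "0 \<le> y" "y \<le> 1 / 2"
      using assms mult_mono[of "norm x" "1/2" "norm q ^ i" 1]
      by (auto simp: y_def power_le_one)
    have "1 - y \<le> norm (1 - x * q ^ i)"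
      using norm_triangle_ineq2[of 1 "x * q ^ i"] by (simp add: norm_mult norm_power y_def)
    then have "norm (inverse (1 - x * q ^ i)) \<le> inverse (1 - y)"
      using y by (simp add: norm_inverse le_imp_inverse_le)
    also have "\<dots> \<le> 1 + 2 * y"
    proof -
      have "0 \<le> y * (1 - 2 * y)" using y by simp
      then have "1 \<le> (1 + 2 * y) * (1 - y)" by (simp add: algebra_simps)
      then show ?thesis using y by (simp add: field_simps)
    qed
    finally show "norm (inverse (1 - x * q ^ i)) \<le> 1 + 2 * norm x * norm q ^ i"
      by (simp add: y_def)
  qed (use assms in auto)
  then show ?thesis
    by (simp add: qpoch_def prod_inversef[symmetric])
qed

lemma bounded_qpoch:
  assumes "norm q < 1" "bounded (f ` A)"
  shows "bounded ((\<lambda>x. qpoch (f x) q (g x)) ` A)"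
proof -
  obtain b where b: "\<And>x. x \<in> A \<Longrightarrow> norm (f x) \<le> b"
    using assms(2) by (auto simp: bounded_iff)
  have "norm (qpoch (f x) q (g x)) \<le> exp (b / (1 - norm q))" if "x \<in> A" for x
  proof -
    have "norm (f x) / (1 - norm q) \<le> b / (1 - norm q)"
      using b[OF that] assms(1) by (intro divide_right_mono) auto
    then show ?thesis
      using norm_qpoch_le[OF assms(1), of "f x" "g x"] by (meson exp_le_cancel_iff order_trans)
  qed
  then show ?thesis by (auto simp: bounded_iff)
qed

text \<open>Compactness gives one \<open>m\<close> with
  \<open>norm (f x * q ^ m) \<le> 1 / 2\<close> for all \<open>x\<close>. Beyond the first
  \<open>m\<close> factors the reciprocal product is bounded uniformly in its length; the finitely
  many shorter lengths are bounded one at a time by compactness.\<close>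

lemma bounded_inverse_qpoch:
  assumes q: "norm q < 1" and f: "compact (f ` A)" and nz: "\<And>x i. x \<in> A \<Longrightarrow> f x * q ^ i \<noteq> 1"
  shows "bounded ((\<lambda>x. inverse (qpoch (f x) q (g x))) ` A)"
proof -
  obtain b where b: "b > 0" "\<And>x. x \<in> A \<Longrightarrow> norm (f x) \<le> b"
    using compact_imp_bounded[OF f] by (auto simp: bounded_pos)
  have "(\<lambda>m. b * norm q ^ m) \<longlonglongrightarrow> b * 0"
    using q by (intro tendsto_intros LIMSEQ_realpow_zero) auto
  then have "eventually (\<lambda>m. b * norm q ^ m < 1 / 2) sequentially"
    by (intro order_tendstoD(2)) auto
  then obtain m where m: "b * norm q ^ m < 1 / 2"
    by (auto simp: eventually_sequentially)
  have small: "norm (f x * q ^ m) \<le> 1 / 2" if "x \<in> A" for x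
    using mult_right_mono[OF b(2)[OF that], of "norm q ^ m"] m
    by (simp add: norm_mult norm_power)
  have "\<exists>c. \<forall>x\<in>A. norm (inverse (qpoch (f x) q l)) \<le> c" for l
  proof -
    have "compact ((\<lambda>y. inverse (qpoch y q l)) ` f ` A)"
      by (intro compact_continuous_image f)
         (use nz in \<open>auto intro!: continuous_intros simp: qpoch_eq_0_iff qpoch_def\<close>)
    then show ?thesis
      by (auto dest!: compact_imp_bounded simp: bounded_iff)
  qed
  then obtain c where c: "\<And>l x. x \<in> A \<Longrightarrow> norm (inverse (qpoch (f x) q l)) \<le> c l"
    by metis
  define C where "C = (\<Sum>l\<le>m. \<bar>c l\<bar>) * exp (1 / (1 - norm q))"
  have e1: "1 \<le> exp (1 / (1 - norm q))" using q by simp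
  have cle: "norm (inverse (qpoch (f x) q l)) \<le> (\<Sum>l\<le>m. \<bar>c l\<bar>)" if "x \<in> A" "l \<le> m" for x l
    using c[OF that(1), of l] member_le_sum[of l "{..m}" "\<lambda>l. \<bar>c l\<bar>"] that(2) by auto
  have "norm (inverse (qpoch (f x) q l)) \<le> C" if x: "x \<in> A" for x l
  proof (cases "l \<le> m")
    case True
    then show ?thesis
      using cle[OF x True] mult_left_mono[OF e1, of "\<Sum>l\<le>m. \<bar>c l\<bar>"] unfolding C_def
      by (simp add: sum_nonneg)
  next
    case False
    then obtain d where d: "l = m + d" by (metis le_Suc_ex nle_le)
    have "norm (inverse (qpoch (f x * q ^ m) q d)) \<le> exp (2 * norm (f x * q ^ m) / (1 - norm q))"
      by (rule norm_inverse_qpoch_le[OF q small[OF x]])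
    also have "\<dots> \<le> exp (1 / (1 - norm q))"
      using small[OF x] q by (simp add: divide_right_mono)
    finally show ?thesis
      using cle[OF x order.refl] unfolding C_def d qpoch_add
      by (simp add: norm_mult mult_mono)
  qed
  then show ?thesis by (auto simp: bounded_iff)
qed

text \<open>The partial products are written as telescoping sums, whose increments
  \<open>qpoch y q n * y * q ^ n\<close> (up to sign) satisfy the Weierstrass M-test on a closed
  disc.\<close>

lemma holomorphic_qpoch_inf:
  assumes q: "norm q < 1"
  shows "(\<lambda>x. qpoch_inf x q) holomorphic_on UNIV"
proof (rule holomorphic_uniform_sequence)
  show "(\<lambda>x. qpoch x q n) holomorphic_on UNIV" for n
    unfolding qpoch_def by (intro holomorphic_intros)
next
  fix x :: complex
  define b where "b = norm x + 1"
  have b: "norm y \<le> b" if "y \<in> cball x 1" for y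
    using that norm_triangle_ineq2[of y x] by (auto simp: b_def dist_norm norm_minus_commute)
  have "uniformly_convergent_on (cball x 1) (\<lambda>N y. \<Sum>n<N. qpoch y q (Suc n) - qpoch y q n)"
  proof (rule Weierstrass_m_test'[where M = "\<lambda>n. exp (b / (1 - norm q)) * (b * norm q ^ n)"])
    fix n y assume y: "y \<in> cball x 1"
    have "norm (qpoch y q (Suc n) - qpoch y q n) = norm (qpoch y q n) * (norm y * norm q ^ n)"
      by (simp add: qpoch_Suc algebra_simps norm_mult norm_power)
    also have "\<dots> \<le> exp (norm y / (1 - norm q)) * (b * norm q ^ n)"
      using b[OF y] q by (intro mult_mono norm_qpoch_le) (auto simp: b_def)
    also have "\<dots> \<le> exp (b / (1 - norm q)) * (b * norm q ^ n)"
      using b[OF y] q by (intro mult_right_mono) (auto simp: b_def divide_right_mono)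
    finally show "norm (qpoch y q (Suc n) - qpoch y q n) \<le> exp (b / (1 - norm q)) * (b * norm q ^ n)" .
  qed (use q in \<open>intro summable_mult summable_geometric; simp\<close>)
  then obtain l where l: "uniform_limit (cball x 1) (\<lambda>N y. \<Sum>n<N. qpoch y q (Suc n) - qpoch y q n) l sequentially"
    by (auto simp: uniformly_convergent_on_def)
  have "(\<Sum>n<N. qpoch y q (Suc n) - qpoch y q n) = qpoch y q N - 1" for N y
    by (induction N) simp_all
  with l have "uniform_limit (cball x 1) (\<lambda>N y. qpoch y q N - 1) l sequentially" by simp
  then have "uniform_limit (cball x 1) (\<lambda>N y. qpoch y q N - 1 + 1) (\<lambda>y. l y + 1) sequentially"
    by (intro uniform_limit_add uniform_limit_const)
  then have u: "uniform_limit (cball x 1) (\<lambda>N y. qpoch y q N) (\<lambda>y. l y + 1) sequentially" by simp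
  have "l y + 1 = qpoch_inf y q" if "y \<in> cball x 1" for y
    using tendsto_uniform_limitI[OF u that] qpoch_LIMSEQ[OF q] LIMSEQ_unique by blast
  with u have "uniform_limit (cball x 1) (\<lambda>N y. qpoch y q N) (\<lambda>y. qpoch_inf y q) sequentially"
    by (simp add: uniform_limit_iff)
  then show "\<exists>d>0. cball x d \<subseteq> UNIV \<and> uniform_limit (cball x d) (\<lambda>n x. qpoch x q n) (\<lambda>x. qpoch_inf x q) sequentially"
    by (intro exI[of _ 1]) auto
qed auto

lemma holomorphic_qpoch_inf_compose:
  assumes "norm q < 1" "f holomorphic_on S"
  shows "(\<lambda>x. qpoch_inf (f x) q) holomorphic_on S"
  using holomorphic_on_compose_gen[OF assms(2) holomorphic_qpoch_inf[OF assms(1)]] by (simp add: o_def)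

section \<open>The matrix of a WP-Bailey pair and its inversion\<close>

text \<open>Both \<open>a\<close> and \<open>k\<close> stay free, although the theorem has
  \<open>a = q\<close>, because the inverse matrix arises by exchanging them.\<close>

definition wp_matrix :: "complex \<Rightarrow> complex \<Rightarrow> complex \<Rightarrow> nat \<Rightarrow> nat \<Rightarrow> complex" where
  "wp_matrix q a k n j = (if j \<le> n then qpoch (k / a) q (n - j) * qpoch k q (n + j) /
     (qpoch q q (n - j) * qpoch (a * q) q (n + j)) else 0)"

lemma wp_matrix_gt [simp]: "n < j \<Longrightarrow> wp_matrix q a k n j = 0"
  by (simp add: wp_matrix_def)

text \<open>Certificate (from Gosper's algorithm) that the sum in the orthogonality relation below
  telescopes; \<open>Y = q\<^sup>j\<close>, \<open>N = q\<^sup>n\<close> and \<open>I = q\<^sup>i\<close>.\<close>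

lemma orth_cert:
  fixes a k N I Y :: complex
  assumes "a \<noteq> 0" "k \<noteq> 0" "I \<noteq> 0" "Y \<noteq> 0"
  shows "k / a * (1 - N / Y) * (1 - k * N * Y) * (1 - a / k * (Y / I)) * (1 - a * Y * I)
      - (1 - Y / I) * (1 - k * I * Y) * (1 - k / a * (N / Y)) * (1 - a * N * Y)
    = (k / a - 1) * (1 - N / I) * (1 - k * N * I) * (1 - a * Y\<^sup>2)"
  using assms by (simp add: field_simps) (algebra)

lemma wp_matrix_Suc_col:
  assumes "j < n" "k / a * q ^ (n - j - 1) \<noteq> 1" "a * q ^ (n + j + 1) \<noteq> 1" "\<And>m. q ^ Suc m \<noteq> 1"
  shows "wp_matrix q a k n (Suc j) * ((1 - k / a * q ^ (n - j - 1)) * (1 - a * q ^ (n + j + 1)))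
    = wp_matrix q a k n j * ((1 - q ^ (n - j)) * (1 - k * q ^ (n + j)))"
proof -
  obtain m where m: "n = Suc (j + m)" using assms(1) less_imp_Suc_add by blast
  have "qpoch q q (Suc m) = qpoch q q m * (1 - q ^ Suc m)" "1 - q ^ Suc m \<noteq> 0"
    using assms(4) by (simp_all add: qpoch_Suc)
  then show ?thesis using assms(2,3)
    by (simp add: wp_matrix_def m qpoch_Suc mult_ac divide_simps)
qed

lemma wp_matrix_Suc_row:
  assumes "j \<le> n" "q ^ (n - j + 1) \<noteq> 1" "a * q ^ (n + j + 1) \<noteq> 1"
  shows "wp_matrix q a k (Suc n) j * ((1 - q ^ (n - j + 1)) * (1 - a * q ^ (n + j + 1)))
    = wp_matrix q a k n j * ((1 - k / a * q ^ (n - j)) * (1 - k * q ^ (n + j)))"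
proof -
  obtain m where m: "n = j + m" using assms(1) le_Suc_ex by blast
  show ?thesis using assms(2,3)
    by (simp add: wp_matrix_def m qpoch_Suc Suc_diff_le mult_ac divide_simps)
qed

text \<open>Bressoud's matrix inverse: \<open>wp_matrix q a k\<close> and
  \<open>wp_matrix q k a\<close> are inverse to each other up to diagonal factors. Off the diagonal
  the sum telescopes to \<open>0\<close>; on it a single term remains.\<close>

lemma wp_matrix_orthogonal:
  assumes q: "q \<noteq> 0" "\<And>m. q ^ Suc m \<noteq> 1"
    and a: "a \<noteq> 0" "\<And>m. a * q ^ m \<noteq> 1"
    and k: "k \<noteq> 0" "\<And>m. k * q ^ m \<noteq> 1"
    and ka: "\<And>m. k / a * q ^ m \<noteq> 1"
    and "i \<le> n"
  shows "(\<Sum>j=i..n. wp_matrix q a k n j * (1 - a * q ^ (2 * j)) * (k / a) ^ (j - i) * wp_matrix q k a j i)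
    = (if n = i then (1 - a) * (1 - k) / (1 - k * q ^ (2 * i)) else 0)"
proof (cases "n = i")
  case True
  have *: "qpoch (x * q) q (2 * i) = qpoch x q (2 * i) * (1 - x * q ^ (2 * i)) / (1 - x)" if "x \<noteq> 1" for x
  proof -
    have "(1 - x) * qpoch (x * q) q (2 * i) = qpoch x q (2 * i) * (1 - x * q ^ (2 * i))"
      using qpoch_Suc_shift[of x q "2 * i"] by (simp add: qpoch_Suc)
    then show ?thesis using that by (simp add: eq_divide_eq mult.commute)
  qed
  have nz: "qpoch a q (2 * i) \<noteq> 0" "qpoch k q (2 * i) \<noteq> 0" "1 - a * q ^ (2 * i) \<noteq> 0" "1 - k * q ^ (2 * i) \<noteq> 0"
    using a k by (auto simp: qpoch_eq_0_iff)
  show ?thesis using nz * a k a(2)[of 0] k(2)[of 0] True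
    by (simp add: wp_matrix_def mult_2[symmetric])
next
  case False
  define u where "u j = wp_matrix q a k n j * (1 - a * q ^ (2 * j)) * (k / a) ^ (j - i) * wp_matrix q k a j i" for j
  \<comment> \<open>\<open>A\<close> and \<open>B\<close> collect the factors of the row and column
    ratios: \<open>u (j+1) * B (j+1)\<close> equals \<open>u j * A j\<close> after division by the
    respective \<open>1 - a * q ^ (2 * j)\<close>, while \<open>A j - B j\<close> is
    \<open>\<mu>\<close> times that same factor. Hence the partial sum up to \<open>m\<close> is
    \<open>u m * A m\<close> divided by it and by \<open>\<mu>\<close>. It starts because
    \<open>B i = 0\<close> and ends at \<open>0\<close> because \<open>A n = 0\<close>.\<close>
  define A where "A j = k / a * (1 - q ^ n / q ^ j) * (1 - k * q ^ n * q ^ j) * (1 - a / k * (q ^ j / q ^ i)) * (1 - a * q ^ j * q ^ i)" for j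
  define B where "B j = (1 - q ^ j / q ^ i) * (1 - k * q ^ i * q ^ j) * (1 - k / a * (q ^ n / q ^ j)) * (1 - a * q ^ n * q ^ j)" for j
  define \<mu> where "\<mu> = (k / a - 1) * (1 - q ^ n / q ^ i) * (1 - k * q ^ n * q ^ i)"
  have nz: "1 - a * q ^ (2 * j) \<noteq> 0" for j
    using a(2)[of "2 * j"] by simp
  have "n - i = Suc (n - i - 1)" using False \<open>i \<le> n\<close> by simp
  then have "q ^ n / q ^ i = q ^ Suc (n - i - 1)"
    using \<open>i \<le> n\<close> q(1) by (metis power_diff)
  then have \<mu>: "\<mu> \<noteq> 0"
    using q(2)[of "n - i - 1"] ka[of 0] k(2)[of "n + i"] by (simp add: \<mu>_def power_add mult.assoc)
  have AB: "A j - B j = \<mu> * (1 - a * q ^ (2 * j))" for j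
    unfolding A_def B_def \<mu>_def using orth_cert[of a k "q ^ i" "q ^ j" "q ^ n"] q(1) a(1) k(1)
    by (simp add: power_mult[symmetric] mult.commute[of 2] mult_ac)
  have step: "u (Suc j) * B (Suc j) / (1 - a * q ^ (2 * Suc j)) = u j * A j / (1 - a * q ^ (2 * j))"
    if "i \<le> j" "j < n" for j
  proof -
    have e1: "q ^ n / q ^ Suc j = q ^ (n - j - 1)" "q ^ n / q ^ j = q ^ (n - j)"
      "q ^ Suc j / q ^ i = q ^ (j - i + 1)" "q ^ j / q ^ i = q ^ (j - i)"
      using that q(1) by (simp_all flip: power_diff power_Suc add: Suc_diff_le)
    have c: "wp_matrix q a k n (Suc j) * ((1 - k / a * q ^ (n - j - 1)) * (1 - a * q ^ (n + j + 1)))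
      = wp_matrix q a k n j * ((1 - q ^ (n - j)) * (1 - k * q ^ (n + j)))"
      using wp_matrix_Suc_col[OF that(2) ka a(2) q(2)] .
    have d: "wp_matrix q k a (Suc j) i * ((1 - q ^ (j - i + 1)) * (1 - k * q ^ (j + i + 1)))
      = wp_matrix q k a j i * ((1 - a / k * q ^ (j - i)) * (1 - a * q ^ (j + i)))"
      using q(2)[of "j - i"] k(2)[of "j + i + 1"] by (intro wp_matrix_Suc_row that) simp_all
    have "u (Suc j) * B (Suc j) / (1 - a * q ^ (2 * Suc j))
      = (wp_matrix q a k n (Suc j) * ((1 - k / a * q ^ (n - j - 1)) * (1 - a * q ^ (n + j + 1)))) * (k / a) ^ (Suc j - i)
        * (wp_matrix q k a (Suc j) i * ((1 - q ^ (j - i + 1)) * (1 - k * q ^ (j + i + 1))))"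
      using nz[of "Suc j"] unfolding u_def B_def e1 by (simp add: power_add mult_ac)
    also have "\<dots> = u j * A j / (1 - a * q ^ (2 * j))"
      using nz[of j] that unfolding u_def A_def e1 c d by (simp add: power_add mult_ac Suc_diff_le)
    finally show ?thesis .
  qed
  have "(\<Sum>j=i..m. u j) = u m * A m / (1 - a * q ^ (2 * m)) / \<mu>" if "i \<le> m" "m \<le> n" for m
    using that
  proof (induction m rule: dec_induct)
    case base
    have "B i = 0" using q(1) by (simp add: B_def)
    then show ?case using AB[of i] \<mu> nz[of i] by simp
  next
    case (step m)
    have "(\<Sum>j=i..Suc m. u j) = u m * A m / (1 - a * q ^ (2 * m)) / \<mu> + u (Suc m)"
      using step by simp
    also have "\<dots> = u (Suc m) * (B (Suc m) + \<mu> * (1 - a * q ^ (2 * Suc m))) / (1 - a * q ^ (2 * Suc m)) / \<mu>"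
      using step \<mu> nz[of "Suc m"] \<open>\<And>j. _ \<Longrightarrow> _ \<Longrightarrow> u (Suc j) * _ / _ = _\<close>[of m]
      by (simp add: add_divide_distrib distrib_left)
    also have "B (Suc m) + \<mu> * (1 - a * q ^ (2 * Suc m)) = A (Suc m)"
      using AB[of "Suc m"] by (metis add.commute diff_add_cancel)
    finally show ?case .
  qed
  from this[OF \<open>i \<le> n\<close>] have "(\<Sum>j=i..n. u j) = u n * A n / (1 - a * q ^ (2 * n)) / \<mu>" by simp
  also have "A n = 0" using q(1) by (simp add: A_def)
  finally show ?thesis using False by (simp add: u_def)
qed

section \<open>Creative telescoping for the column sums\<close>

text \<open>Certificate for the recurrence of step 2 in \<open>j\<close>, with \<open>J = q\<^sup>j\<close> and \<open>X = q\<^sup>n\<close>. The value of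
  \<open>rat_R\<close> is the ratio of the coefficients of \<open>\<alpha>\<close> at \<open>j + 2\<close> and \<open>j\<close>.\<close>

definition cert_p where
  "cert_p q k J = - (k - q\<^sup>2) * (1 - J\<^sup>2 * q ^ 3) / (k * (1 - J * q ^ 4 / k\<^sup>2) * (1 - J * q ^ 3))"

definition rat_R :: "complex \<Rightarrow> complex \<Rightarrow> complex \<Rightarrow> complex" where
  "rat_R q k J = (1 - J) * (1 - k\<^sup>2 * J / q) * q ^ 4 / ((1 - J * q ^ 4 / k\<^sup>2) * (1 - J * q ^ 3) * k\<^sup>2)"

text \<open>The equation \<open>s - R * t = G (n+1) - G n\<close>, divided by \<open>t\<close> and
  with the denominators in \<open>X\<close> cleared.\<close>

lemma cert_poly:
  fixes q k J X :: complex
  assumes "q \<noteq> 0" "k \<noteq> 0" "J \<noteq> 0" "1 - J * q ^ 4 / k\<^sup>2 \<noteq> 0" "1 - J * q ^ 3 \<noteq> 0"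
  shows "(1 - k * X\<^sup>2) * ((1 - X / J) * (1 - X / (q * J)) * (1 - k * X * J) * (1 - k * X * J * q)
         - rat_R q k J * (1 - k * X / (q\<^sup>2 * J)) * (1 - k * X / (q ^ 3 * J)) * (1 - X * J * q\<^sup>2) * (1 - X * J * q ^ 3))
    = cert_p q k J * (- (q\<^sup>2) / k * (1 - X) * (1 - k\<^sup>2 * X / q) * (1 - q\<^sup>2 * X\<^sup>2) * (1 - k * X / (q ^ 3 * J)) * (1 - k * X * J)
         - (1 - q * X / k) * (1 - k * X) * (1 - k\<^sup>2 * X\<^sup>2 / q\<^sup>2) * (1 - X / J) * (1 - X * J * q ^ 3))"
proof -
  define D where "D = (k\<^sup>2 - J * q ^ 4) * (1 - J * q ^ 3)"
  have "k\<^sup>2 - J * q ^ 4 = k\<^sup>2 * (1 - J * q ^ 4 / k\<^sup>2)" using assms by (simp add: field_simps)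
  then have D: "D \<noteq> 0" using assms unfolding D_def by simp
  have R: "rat_R q k J = (1 - J) * (q - k\<^sup>2 * J) * q ^ 3 / D"
    using assms D by (simp add: rat_R_def D_def divide_simps) (simp add: algebra_simps power_numeral_reduce)
  have p: "cert_p q k J = - k * (k - q\<^sup>2) * (1 - J\<^sup>2 * q ^ 3) / D"
    using assms D by (simp add: cert_p_def D_def divide_simps) (simp add: algebra_simps power_numeral_reduce)
  \<comment> \<open>With \<open>X = u * J\<close> the quotients by \<open>J\<close> become
    polynomials in \<open>u\<close>, and after pulling out \<open>D\<close> and powers of
    \<open>q\<close> and \<open>k\<close> the identity is polynomial.\<close>
  define u where "u = X / J"
  have X: "X = u * J" using assms by (simp add: u_def)
  have f: "1 - X / J = 1 - u" "1 - X / (q * J) = (q - u) / q"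
     "1 - k * X / (q\<^sup>2 * J) = (q\<^sup>2 - k * u) / q\<^sup>2" "1 - k * X / (q ^ 3 * J) = (q ^ 3 - k * u) / q ^ 3"
     "1 - k\<^sup>2 * X / q = (q - k\<^sup>2 * X) / q" "1 - q * X / k = (k - q * X) / k"
     "1 - k\<^sup>2 * X\<^sup>2 / q\<^sup>2 = (q\<^sup>2 - k\<^sup>2 * X\<^sup>2) / q\<^sup>2"
    using assms by (simp_all add: u_def field_simps)
  define a where "a = (1 - k * X\<^sup>2) * (D * (1 - u) * (q - u) * (1 - k * X * J) * (1 - k * X * J * q))"
  define b where "b = (1 - k * X\<^sup>2) * ((1 - J) * (q - k\<^sup>2 * J) * (q\<^sup>2 - k * u) * (q ^ 3 - k * u) * (1 - X * J * q\<^sup>2) * (1 - X * J * q ^ 3))"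
  define c where "c = (k - q\<^sup>2) * (1 - J\<^sup>2 * q ^ 3) * ((1 - X) * (q - k\<^sup>2 * X) * (1 - q\<^sup>2 * X\<^sup>2) * (q ^ 3 - k * u) * (1 - k * X * J))"
  define d where "d = (k - q\<^sup>2) * (1 - J\<^sup>2 * q ^ 3) * ((k - q * X) * (1 - k * X) * (q\<^sup>2 - k\<^sup>2 * X\<^sup>2) * (1 - u) * (1 - X * J * q ^ 3))"
  have "a * q - b = c + d"
    unfolding a_def b_def c_def d_def X D_def by algebra
  then have e: "a / D / q - b / D / q\<^sup>2 = (c + d) / D / q\<^sup>2"
    using assms(1) D by (simp add: field_simps power2_eq_square)
  have "(1 - k * X\<^sup>2) * ((1 - X / J) * (1 - X / (q * J)) * (1 - k * X * J) * (1 - k * X * J * q)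
         - rat_R q k J * (1 - k * X / (q\<^sup>2 * J)) * (1 - k * X / (q ^ 3 * J)) * (1 - X * J * q\<^sup>2) * (1 - X * J * q ^ 3))
     = a / D / q - b / D / q\<^sup>2"
    unfolding f R right_diff_distrib[of "1 - k * X\<^sup>2"]
    by (rule arg_cong2[where f = minus]; use assms(1) D in \<open>simp add: a_def b_def divide_simps\<close>)
  moreover have "cert_p q k J * (- (q\<^sup>2) / k * (1 - X) * (1 - k\<^sup>2 * X / q) * (1 - q\<^sup>2 * X\<^sup>2) * (1 - k * X / (q ^ 3 * J)) * (1 - k * X * J)
         - (1 - q * X / k) * (1 - k * X) * (1 - k\<^sup>2 * X\<^sup>2 / q\<^sup>2) * (1 - X / J) * (1 - X * J * q ^ 3))
     = c / D / q\<^sup>2 - - d / D / q\<^sup>2"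
    unfolding f p right_diff_distrib[of "_ / D"]
    by (rule arg_cong2[where f = minus]; use assms(1,2) D in \<open>simp add: c_def d_def divide_simps; simp add: power_numeral_reduce\<close>)
  ultimately show ?thesis using e by (simp add: add_divide_distrib)
qed

text \<open>The antidifference is the summand times \<open>cert_g\<close> at \<open>X = q^n\<close>.
  Apart from \<open>cert_p\<close>, the numerator is chosen so that its shift cancels denominators
  of the ratio of consecutive summands. Its factor \<open>1 - X / J\<close> makes the antidifference
  vanish at \<open>n = j\<close>.\<close>

definition cert_g where
  "cert_g q k J X = cert_p q k J * (1 - q * X / k) * (1 - k * X) * (1 - k\<^sup>2 * X\<^sup>2 / q\<^sup>2) * (1 - X / J)
     / ((1 - k * X\<^sup>2) * (1 - k * X / (q\<^sup>2 * J)) * (1 - k * X / (q ^ 3 * J)) * (1 - X * J * q\<^sup>2))"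

text \<open>Here \<open>t\<close> and \<open>t'\<close> are consecutive entries of one column and
  \<open>s\<close> is the entry two columns further on. \<open>J\<close> is kept abstract because
  the step is also taken at \<open>J = 1 / q\<close>, the virtual column \<open>-1\<close>.\<close>

lemma cert_step:
  fixes q k J X s t t' :: complex
  assumes "q \<noteq> 0" "k \<noteq> 0" "J \<noteq> 0" "1 - J * q ^ 4 / k\<^sup>2 \<noteq> 0" "1 - J * q ^ 3 \<noteq> 0"
    and nz: "1 - k * X\<^sup>2 \<noteq> 0" "1 - k * X / (q\<^sup>2 * J) \<noteq> 0" "1 - k * X / (q ^ 3 * J) \<noteq> 0"
      "1 - X * J * q\<^sup>2 \<noteq> 0" "1 - X * J * q ^ 3 \<noteq> 0" "1 - k * q\<^sup>2 * X\<^sup>2 \<noteq> 0" "1 - k * X / (q * J) \<noteq> 0"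
      "1 - q\<^sup>2 * X / k \<noteq> 0" "1 - k * q * X \<noteq> 0" "1 - k\<^sup>2 * X\<^sup>2 \<noteq> 0" "1 - q * X / J \<noteq> 0"
    and s: "s = t * ((1 - X / J) * (1 - X / (q * J)) * (1 - k * X * J) * (1 - k * X * J * q)
        / ((1 - k * X / (q\<^sup>2 * J)) * (1 - k * X / (q ^ 3 * J)) * (1 - X * J * q\<^sup>2) * (1 - X * J * q ^ 3)))"
    and t': "t' = t * ((1 - k * q\<^sup>2 * X\<^sup>2) * (1 - X) * (1 - k\<^sup>2 * X / q) * (1 - q\<^sup>2 * X\<^sup>2)
        / ((1 - k * X\<^sup>2) * (1 - q\<^sup>2 * X / k) * (1 - k * q * X) * (1 - k\<^sup>2 * X\<^sup>2)) * (- (q\<^sup>2) / k)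
        * ((1 - k * X / (q * J)) * (1 - k * X * J) / ((1 - q * X / J) * (1 - X * J * q\<^sup>2))))"
  shows "s - rat_R q k J * t = t' * cert_g q k J (q * X) - t * cert_g q k J X"
proof -
  define d1 d2 d3 d4 d5 where d: "d1 = 1 - k * X\<^sup>2" "d2 = 1 - k * X / (q\<^sup>2 * J)" "d3 = 1 - k * X / (q ^ 3 * J)"
      "d4 = 1 - X * J * q\<^sup>2" "d5 = 1 - X * J * q ^ 3"
  define e1 e2 e3 e4 e5 e6 where e: "e1 = 1 - k * q\<^sup>2 * X\<^sup>2" "e2 = 1 - k * X / (q * J)"
      "e3 = 1 - q\<^sup>2 * X / k" "e4 = 1 - k * q * X" "e5 = 1 - k\<^sup>2 * X\<^sup>2" "e6 = 1 - q * X / J"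
  define f1 f2 f3 f4 f5 where f: "f1 = 1 - X / J" "f2 = 1 - q * X / k" "f3 = 1 - k * X"
     "f4 = 1 - k\<^sup>2 * X\<^sup>2 / q\<^sup>2" "f5 = 1 - k * X * J"
  define h2 h3 where h: "h2 = (1 - X / (q * J)) * (1 - k * X * J * q)"
     "h3 = (1 - X) * (1 - k\<^sup>2 * X / q) * (1 - q\<^sup>2 * X\<^sup>2)"
  define R p r where Rp: "R = rat_R q k J" "p = cert_p q k J" "r = - (q\<^sup>2) / k"
  have nz': "d1 \<noteq> 0" "d2 \<noteq> 0" "d3 \<noteq> 0" "d4 \<noteq> 0" "d5 \<noteq> 0" "e1 \<noteq> 0" "e2 \<noteq> 0" "e3 \<noteq> 0" "e4 \<noteq> 0" "e5 \<noteq> 0" "e6 \<noteq> 0"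
    using nz by (simp_all add: d e)
  have g1: "cert_g q k J X = p * f2 * f3 * f4 * f1 / (d1 * d2 * d3 * d4)"
    by (simp add: cert_g_def d f Rp)
  have g2: "cert_g q k J (q * X) = p * e3 * e4 * e5 * e6 / (e1 * e2 * d2 * d5)"
    using assms(1-3) by (simp add: cert_g_def d e Rp power_mult_distrib power2_eq_square power3_eq_cube mult_ac)
  have "d1 * (f1 * f5 * h2 - R * d2 * d3 * d4 * d5) = p * (r * h3 * d3 * f5 - f2 * f3 * f4 * f1 * d5)"
    using cert_poly[OF assms(1-5), of X] unfolding d e f h Rp by (simp only: mult_ac)
  moreover have s': "s = t * (f1 * f5 * h2 / (d2 * d3 * d4 * d5))"
    unfolding s d e f h by (simp only: mult_ac)
  moreover have t'': "t' = t * (e1 * h3 * r * e2 * f5 / (d1 * e3 * e4 * e5 * e6 * d4))"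
    unfolding t' d e f h Rp by (simp only: mult_ac times_divide_eq_left times_divide_eq_right divide_divide_eq_left)
  moreover have "f1 * f5 * h2 / (d2 * d3 * d4 * d5) - R = d1 * (f1 * f5 * h2 - R * d2 * d3 * d4 * d5) / (d1 * d2 * d3 * d4 * d5)"
    using nz' by (simp add: field_simps)
  moreover have "e1 * h3 * r * e2 * f5 / (d1 * e3 * e4 * e5 * e6 * d4) * (p * e3 * e4 * e5 * e6 / (e1 * e2 * d2 * d5))
       - p * f2 * f3 * f4 * f1 / (d1 * d2 * d3 * d4)
     = p * (r * h3 * d3 * f5 - f2 * f3 * f4 * f1 * d5) / (d1 * d2 * d3 * d4 * d5)"
    using nz' by (simp add: divide_simps) (simp add: algebra_simps)
  ultimately have "t * (f1 * f5 * h2 / (d2 * d3 * d4 * d5) - R)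
     = t * (e1 * h3 * r * e2 * f5 / (d1 * e3 * e4 * e5 * e6 * d4) * (p * e3 * e4 * e5 * e6 / (e1 * e2 * d2 * d5))
       - p * f2 * f3 * f4 * f1 / (d1 * d2 * d3 * d4))"
    by simp
  then show ?thesis
    unfolding g1 g2 Rp(1)[symmetric] s' t'' by (simp add: algebra_simps)
qed

text \<open>For \<open>\<bar>q\<bar> < 1\<close> this is what the denominator hypotheses of the theorem say about \<open>k\<close>.\<close>

definition admissible :: "complex \<Rightarrow> complex \<Rightarrow> bool" where
  "admissible q k \<longleftrightarrow> k \<noteq> 0 \<and> (\<forall>m. k\<^sup>2 * q ^ (2 * m) \<noteq> 1 \<and> k\<^sup>2 \<noteq> q ^ (2 * m + 2) \<and> k\<^sup>2 \<noteq> q ^ (2 * m + 3))"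

text \<open>The coefficient of \<open>\<beta> n\<close> without its geometric factor; what remains
  converges in \<open>n\<close>. The truncated \<open>n - 1\<close> gives a nonzero value at
  \<open>n = 0\<close>, which \<open>beta_weight\<close> overrides with \<open>0\<close> because the
  sum of the theorem starts at \<open>n = 1\<close>.\<close>

definition beta_coeff :: "complex \<Rightarrow> complex \<Rightarrow> nat \<Rightarrow> complex" where
  "beta_coeff q k n = (1 - k * q ^ (2 * n)) * qpoch q q (n - 1) * qpoch (k^2 / q) q n * qpoch (q^2) (q^2) n
     / ((1 - k) * (qpoch (q^2 / k) q n * qpoch (k * q) q n) * qpoch (k^2) (q^2) n)"

definition beta_weight :: "complex \<Rightarrow> complex \<Rightarrow> nat \<Rightarrow> complex" where
  "beta_weight q k n = (if n = 0 then 0 else beta_coeff q k n * (- (q^2) / k) ^ n)"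

text \<open>Index \<open>n\<close> belongs to \<open>\<alpha> (2 * n + 2)\<close>; the power
  \<open>2 * n + 2\<close> of \<open>- (q^2) / k\<close> has been removed.\<close>

definition even_coeff :: "complex \<Rightarrow> complex \<Rightarrow> nat \<Rightarrow> complex" where
  "even_coeff q k n = qpoch (q^2) (q^2) n * qpoch (k^2 / q) (q^2) (Suc n)
     / (qpoch (q^4 / k^2) (q^2) (Suc n) * qpoch (q^3) (q^2) (Suc n))"

text \<open>Index \<open>n\<close> belongs to \<open>\<alpha> (2 * n + 1)\<close>; besides the
  infinite product, the power \<open>2 * n + 2\<close> of \<open>- (q^2) / k\<close> has been
  removed, one more than the index of \<open>\<alpha>\<close>.\<close>

definition odd_coeff :: "complex \<Rightarrow> complex \<Rightarrow> nat \<Rightarrow> complex" where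
  "odd_coeff q k n = qpoch (k^2 / q^2) (q^2) (Suc n) * qpoch (1 / q) (q^2) (Suc n)
     / (qpoch (q^3 / k^2) (q^2) (Suc n) * qpoch (q^2) (q^2) (Suc n))"

text \<open>The constant on the left of the theorem. It originates as the boundary term of the
  telescoping for the virtual column \<open>-1\<close>.\<close>

definition pole_term :: "complex \<Rightarrow> complex \<Rightarrow> complex" where
  "pole_term q k = (k^2 - q) * (k - q^2) / ((1 - k) * (1 - q) * (k^2 - q^2))"

definition theta_quot :: "complex \<Rightarrow> complex \<Rightarrow> complex" where
  "theta_quot q k = k * (qpochs_inf [k^2 * q, q / k^2, q^2, q^2] (q^2)
            / qpochs_inf [k^2, q^2 / k^2, q, q] (q^2))"

text \<open>The coefficients of \<open>\<alpha>\<close> once all terms without \<open>\<beta>\<close> are on one side; since \<open>\<alpha> 0 = \<beta> 0 = 1\<close>,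
  the terms without \<open>\<alpha>\<close> form the coefficient at \<open>0\<close>, and that of \<open>\<beta> 0\<close> is \<open>0\<close>.\<close>

definition alpha_weight :: "complex \<Rightarrow> complex \<Rightarrow> nat \<Rightarrow> complex" where
  "alpha_weight q k j = (if j = 0 then theta_quot q k - pole_term q k
     else if even j then even_coeff q k (j div 2 - 1) * (- (q^2) / k) ^ j
     else theta_quot q k * odd_coeff q k (j div 2) * (- (q^2) / k) ^ Suc j)"

definition bailey_term :: "complex \<Rightarrow> complex \<Rightarrow> nat \<Rightarrow> nat \<Rightarrow> complex" where
  "bailey_term q k n j = beta_weight q k n * wp_matrix q q k n j"

definition column_sum :: "complex \<Rightarrow> complex \<Rightarrow> nat \<Rightarrow> complex" where
  "column_sum q k j = (\<Sum>n. bailey_term q k n j)"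

section \<open>Nonvanishing of denominators and ratios of neighbouring terms\<close>

context
  fixes q :: complex
  assumes q: "0 < norm q" "norm q < 1"
begin

lemma q_nonzero: "q \<noteq> 0"
  using q by auto

lemma norm_q2: "norm (q\<^sup>2) < 1"
  using q by (simp add: norm_power power_less_one_iff)

lemma q_power_ne_1: "n > 0 \<Longrightarrow> q ^ n \<noteq> 1"
  using q by (metis norm_one norm_power power_less_one_iff norm_ge_zero less_irrefl)

lemma q_power_LIMSEQ: "(\<lambda>n. q ^ n) \<longlonglongrightarrow> 0"
  using q by (intro LIMSEQ_power_zero) auto

context
  fixes k :: complex
  assumes k: "admissible q k"
begin

lemma k_nonzero: "k \<noteq> 0"
  using k by (simp add: admissible_def)

text \<open>Two natural exponents express that \<open>k\<close> is no integral power of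
  \<open>q\<close>. Squaring such a power gives an even power of \<open>q\<close>, and all even
  powers are excluded for \<open>k^2\<close> by admissibility.\<close>

lemma k_power_ne: "k * q ^ m \<noteq> q ^ l"
proof
  assume *: "k * q ^ m = q ^ l"
  show False
  proof (cases "l \<le> m")
    case True
    then have "q ^ m = q ^ (m - l) * q ^ l" by (simp flip: power_add)
    with * have "k * q ^ (m - l) = 1" using q_nonzero by simp
    then have "(k * q ^ (m - l))\<^sup>2 = 1" by simp
    then show False using k by (simp add: admissible_def power_mult_distrib power_mult[symmetric] mult.commute)
  next
    case False
    then have "q ^ l = q ^ (l - m) * q ^ m" by (simp flip: power_add)
    with * have "k = q ^ (l - m)" using q_nonzero by simp
    moreover from False obtain d where "l - m = Suc d" by (metis Suc_diff_Suc not_le)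
    ultimately have "k\<^sup>2 = q ^ (2 * d + 2)"
      by (simp add: power_mult power_mult_distrib power2_eq_square)
    then show False using k unfolding admissible_def by blast
  qed
qed

lemma k_power_ne_1: "k * q ^ m \<noteq> 1"
  using k_power_ne[of m 0] by simp

lemma k_div_q_power_ne_1: "k / q * q ^ m \<noteq> 1"
  using k_power_ne[of m 1] q_nonzero by (simp add: field_simps)

lemma q2_div_k_power_ne_1: "q\<^sup>2 / k * q ^ m \<noteq> 1"
  using k_power_ne[of 0 "m + 2"] k_nonzero by (auto simp: field_simps power_add power2_eq_square)

lemma k2_power_ne_1: "k\<^sup>2 * (q\<^sup>2) ^ m \<noteq> 1"
  using k by (simp add: admissible_def power_mult)

lemma k2_ne_power: "k\<^sup>2 \<noteq> q ^ (l + 2)"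
proof (cases "even l")
  case True
  then obtain m where "l = 2 * m" by blast
  then show ?thesis using k by (simp add: admissible_def)
next
  case False
  then obtain m where "l = 2 * m + 1" using oddE by blast
  moreover have "2 * m + 1 + 2 = 2 * m + 3" by simp
  ultimately show ?thesis using k unfolding admissible_def by metis
qed

lemma q4_div_k2_ne_1: "q ^ 4 / k\<^sup>2 * (q\<^sup>2) ^ m \<noteq> 1"
  using k2_ne_power[of "2 * m + 2"] k_nonzero
  by (auto simp: field_simps power_add power_mult power2_eq_square power_numeral_reduce)

lemma q3_div_k2_ne_1: "q ^ 3 / k\<^sup>2 * (q\<^sup>2) ^ m \<noteq> 1"
  using k2_ne_power[of "2 * m + 1"] k_nonzero
  by (auto simp: field_simps power_add power_mult power2_eq_square power_numeral_reduce)

lemma q2_div_k2_ne_1: "q\<^sup>2 / k\<^sup>2 * (q\<^sup>2) ^ m \<noteq> 1"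
  using k2_ne_power[of "2 * m"] k_nonzero
  by (auto simp: field_simps power_add power_mult power2_eq_square power_numeral_reduce)

lemma q_power_mult_ne_1: "0 < j \<Longrightarrow> q ^ j * (q\<^sup>2) ^ m \<noteq> 1"
  using q_power_ne_1[of "j + 2 * m"] by (simp add: power_add power_mult)

lemma beta_coeff_Suc:
  assumes "n > 0"
  shows "beta_coeff q k (Suc n) = beta_coeff q k n *
    ((1 - k * q\<^sup>2 * (q ^ n)\<^sup>2) * (1 - q ^ n) * (1 - k\<^sup>2 * q ^ n / q) * (1 - q\<^sup>2 * (q ^ n)\<^sup>2)
        / ((1 - k * (q ^ n)\<^sup>2) * (1 - q\<^sup>2 * q ^ n / k) * (1 - k * q * q ^ n) * (1 - k\<^sup>2 * (q ^ n)\<^sup>2)))"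
proof -
  obtain m where m: "n = Suc m" using assms by (cases n) auto
  have 1: "qpoch q q (Suc n - 1) = qpoch q q (n - 1) * (1 - q ^ n)"
    by (simp add: m qpoch_Suc)
  have 2: "1 - k * (q ^ n)\<^sup>2 \<noteq> 0"
    using k_power_ne_1[of "2 * n"] by (simp add: power_mult[symmetric] mult.commute)
  have 3: "k * q ^ (2 * Suc n) = k * q\<^sup>2 * (q ^ n)\<^sup>2" "q ^ (2 * n) = (q ^ n)\<^sup>2" "(q\<^sup>2) ^ n = (q ^ n)\<^sup>2"
    by (simp_all add: mult_2 power_add power_mult_distrib power2_eq_square)
  show ?thesis
    unfolding beta_coeff_def qpoch_Suc 1 3 using 2 by (simp add: mult_ac)
qed

lemma rat_R_power:
  "rat_R q k J = (1 - J) * (1 - k\<^sup>2 / q * J) / ((1 - q ^ 4 / k\<^sup>2 * J) * (1 - q ^ 3 * J)) * (- (q\<^sup>2) / k)\<^sup>2"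
  by (simp add: rat_R_def power2_eq_square power_numeral_reduce mult_ac)

text \<open>The step factor is the one satisfied by the column sums, so agreement at the first index
  will propagate; the odd coefficients share it.\<close>

lemma even_coeff_Suc:
  "even_coeff q k (Suc n) * (- (q\<^sup>2) / k) ^ (2 * n + 4)
    = rat_R q k (q ^ (2 * n + 2)) * (even_coeff q k n * (- (q\<^sup>2) / k) ^ (2 * n + 2))"
proof -
  define Z where "Z = q ^ (2 * n)"
  have Z: "(q\<^sup>2) ^ n = Z" "(q\<^sup>2) ^ Suc n = q * q * Z" "q ^ (2 * n + 2) = q * q * Z" "q ^ (2 * n + 1) = q * Z"
    by (simp_all add: Z_def power_mult power2_eq_square)
  have "(1 - q ^ (2 * n + 2)) * (1 - k\<^sup>2 / q * q ^ (2 * n + 2)) / ((1 - q ^ 4 / k\<^sup>2 * q ^ (2 * n + 2)) * (1 - q ^ 3 * q ^ (2 * n + 2)))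
   = (1 - q\<^sup>2 * (q\<^sup>2) ^ n) * (1 - k\<^sup>2 / q * (q\<^sup>2) ^ Suc n) / ((1 - q ^ 4 / k\<^sup>2 * (q\<^sup>2) ^ Suc n) * (1 - q ^ 3 * (q\<^sup>2) ^ Suc n))"
    unfolding Z by (simp add: power2_eq_square power_numeral_reduce mult_ac)
  moreover have "even_coeff q k (Suc n) = even_coeff q k n * ((1 - q\<^sup>2 * (q\<^sup>2) ^ n) * (1 - k\<^sup>2 / q * (q\<^sup>2) ^ Suc n) / ((1 - q ^ 4 / k\<^sup>2 * (q\<^sup>2) ^ Suc n) * (1 - q ^ 3 * (q\<^sup>2) ^ Suc n)))"
    by (simp only: even_coeff_def qpoch_Suc[of _ _ "Suc n"] qpoch_Suc[of "q\<^sup>2"] times_divide_times_eq) (simp only: mult_ac)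
  moreover have "(- (q\<^sup>2) / k) ^ (2 * n + 4) = (- (q\<^sup>2) / k)\<^sup>2 * (- (q\<^sup>2) / k) ^ (2 * n + 2)"
  proof -
    have "2 * n + 4 = 2 + (2 * n + 2)" by simp
    then show ?thesis by (simp only: power_add)
  qed
  ultimately show ?thesis
    unfolding rat_R_power by (simp only: mult_ac)
qed

lemma odd_coeff_Suc:
  "odd_coeff q k (Suc n) * (- (q\<^sup>2) / k) ^ (2 * n + 4)
    = rat_R q k (q ^ (2 * n + 1)) * (odd_coeff q k n * (- (q\<^sup>2) / k) ^ (2 * n + 2))"
proof -
  define Z where "Z = q ^ (2 * n)"
  have Z: "(q\<^sup>2) ^ n = Z" "(q\<^sup>2) ^ Suc n = q * q * Z" "q ^ (2 * n + 2) = q * q * Z" "q ^ (2 * n + 1) = q * Z"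
    by (simp_all add: Z_def power_mult power2_eq_square)
  have "(1 - q ^ (2 * n + 1)) * (1 - k\<^sup>2 / q * q ^ (2 * n + 1)) / ((1 - q ^ 4 / k\<^sup>2 * q ^ (2 * n + 1)) * (1 - q ^ 3 * q ^ (2 * n + 1)))
   = (1 - k\<^sup>2 / q\<^sup>2 * (q\<^sup>2) ^ Suc n) * (1 - 1 / q * (q\<^sup>2) ^ Suc n) / ((1 - q ^ 3 / k\<^sup>2 * (q\<^sup>2) ^ Suc n) * (1 - q\<^sup>2 * (q\<^sup>2) ^ Suc n))"
    unfolding Z using q_nonzero by (simp add: power2_eq_square power_numeral_reduce mult_ac)
  moreover have "odd_coeff q k (Suc n) = odd_coeff q k n * ((1 - k\<^sup>2 / q\<^sup>2 * (q\<^sup>2) ^ Suc n) * (1 - 1 / q * (q\<^sup>2) ^ Suc n) / ((1 - q ^ 3 / k\<^sup>2 * (q\<^sup>2) ^ Suc n) * (1 - q\<^sup>2 * (q\<^sup>2) ^ Suc n)))"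
    by (simp only: odd_coeff_def qpoch_Suc[of _ _ "Suc n"] times_divide_times_eq) (simp only: mult_ac)
  moreover have "(- (q\<^sup>2) / k) ^ (2 * n + 4) = (- (q\<^sup>2) / k)\<^sup>2 * (- (q\<^sup>2) / k) ^ (2 * n + 2)"
  proof -
    have "2 * n + 4 = 2 + (2 * n + 2)" by simp
    then show ?thesis by (simp only: power_add)
  qed
  ultimately show ?thesis
    unfolding rat_R_power by (simp only: mult_ac)
qed

text \<open>The recurrence of the odd coefficients, started at column \<open>-1\<close> with the
  value \<open>1\<close>.\<close>

lemma odd_coeff_0: "odd_coeff q k 0 * (- (q\<^sup>2) / k)\<^sup>2 = rat_R q k (1 / q)"
  using q_nonzero k_nonzero
  by (simp add: odd_coeff_def rat_R_power qpoch_def power2_eq_square power_numeral_reduce)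

lemma q_power_Suc_ne_1: "q ^ Suc m \<noteq> 1"
  by (rule q_power_ne_1) simp

lemma wp_matrix_Suc_col_q:
  assumes "j < n"
  shows "wp_matrix q q k n (Suc j) * ((1 - k / q * q ^ (n - j - 1)) * (1 - q * q ^ (n + j + 1)))
    = wp_matrix q q k n j * ((1 - q ^ (n - j)) * (1 - k * q ^ (n + j)))"
  using q_power_Suc_ne_1[of "n + j + 1"]
  by (intro wp_matrix_Suc_col assms k_div_q_power_ne_1 q_power_Suc_ne_1) simp

lemma wp_matrix_row_ratio:
  assumes "j \<le> n"
  shows "wp_matrix q q k (Suc n) j = wp_matrix q q k n j *
     ((1 - k * q ^ n / (q * q ^ j)) * (1 - k * q ^ n * q ^ j) / ((1 - q * q ^ n / q ^ j) * (1 - q ^ n * q ^ j * q\<^sup>2)))"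
proof -
  have p: "q * q ^ n / q ^ j = q ^ (n - j + 1)" "k / q * q ^ (n - j) = k * q ^ n / (q * q ^ j)"
    using assms q_nonzero by (simp_all add: power_diff)
  have nz: "1 - q * q ^ n / q ^ j \<noteq> 0" "1 - q ^ n * q ^ j * q\<^sup>2 \<noteq> 0"
    unfolding p using q_power_ne_1[of "n - j + 1"] q_power_ne_1[of "n + j + 2"]
    by (simp_all add: power_add mult_ac power2_eq_square)
  have "wp_matrix q q k (Suc n) j * ((1 - q * q ^ n / q ^ j) * (1 - q ^ n * q ^ j * q\<^sup>2))
      = wp_matrix q q k n j * ((1 - k * q ^ n / (q * q ^ j)) * (1 - k * q ^ n * q ^ j))"
    using wp_matrix_Suc_row[OF assms, of q q k] q_power_ne_1[of "n - j + 1"] q_power_ne_1[of "n + j + 2"]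
    unfolding p by (simp add: power_add mult_ac power2_eq_square)
  then show ?thesis
    using nz by (intro eq_times_divideI) simp_all
qed

lemma q_frac_ne_1: "q ^ a / q ^ b \<noteq> 1" if "a > b"
  using q_power_ne_1[of "a - b"] that q_nonzero by (simp add: power_diff)

lemma k_frac_ne: "1 - k * q ^ a / q ^ b \<noteq> 0"
  using k_power_ne[of a b] q_nonzero by (simp add: field_simps)

lemma wp_matrix_col_ratio:
  assumes "j \<le> n"
  shows "wp_matrix q q k n (j + 2) = wp_matrix q q k n j *
     ((1 - q ^ n / q ^ j) * (1 - q ^ n / (q * q ^ j)) * (1 - k * q ^ n * q ^ j) * (1 - k * q ^ n * q ^ j * q)
        / ((1 - k * q ^ n / (q\<^sup>2 * q ^ j)) * (1 - k * q ^ n / (q ^ 3 * q ^ j)) * (1 - q ^ n * q ^ j * q\<^sup>2) * (1 - q ^ n * q ^ j * q ^ 3)))"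
proof -
  \<comment> \<open>For \<open>n = j\<close> and \<open>n = j + 1\<close> the entry on the left is
    \<open>0\<close>, and so is one of the first two numerator factors.\<close>
  consider "n = j" | "n = Suc j" | "j + 2 \<le> n" using assms by linarith
  then show ?thesis
  proof cases
    case 3
    have c1: "k / q * q ^ (n - j - 1) = k * q ^ n / (q\<^sup>2 * q ^ j)" "q ^ (n - j) = q ^ n / q ^ j"
       "k / q * q ^ (n - Suc j - 1) = k * q ^ n / (q ^ 3 * q ^ j)" "q ^ (n - Suc j) = q ^ n / (q * q ^ j)"
      using 3 q_nonzero by (simp_all add: power_diff power2_eq_square power3_eq_cube)
    have c2: "q * q ^ (n + j + 1) = q ^ n * q ^ j * q\<^sup>2" "q * q ^ (n + Suc j + 1) = q ^ n * q ^ j * q ^ 3"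
      "k * q ^ (n + j) = k * q ^ n * q ^ j" "k * q ^ (n + Suc j) = k * q ^ n * q ^ j * q"
      by (simp_all add: power_add power2_eq_square power3_eq_cube mult_ac)
    have nz: "1 - k * q ^ n / (q\<^sup>2 * q ^ j) \<noteq> 0" "1 - k * q ^ n / (q ^ 3 * q ^ j) \<noteq> 0"
       "1 - q ^ n * q ^ j * q\<^sup>2 \<noteq> 0" "1 - q ^ n * q ^ j * q ^ 3 \<noteq> 0"
      using k_frac_ne[of n "2 + j"] k_frac_ne[of n "3 + j"] q_power_ne_1[of "n + j + 2"] q_power_ne_1[of "n + j + 3"]
      unfolding power_add by (simp_all add: mult_ac)
    have "wp_matrix q q k n (Suc j) * ((1 - k * q ^ n / (q\<^sup>2 * q ^ j)) * (1 - q ^ n * q ^ j * q\<^sup>2))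
      = wp_matrix q q k n j * ((1 - q ^ n / q ^ j) * (1 - k * q ^ n * q ^ j))"
      using wp_matrix_Suc_col_q[of j n] 3 unfolding c1 c2 by simp
    moreover have "wp_matrix q q k n (Suc (Suc j)) * ((1 - k * q ^ n / (q ^ 3 * q ^ j)) * (1 - q ^ n * q ^ j * q ^ 3))
      = wp_matrix q q k n (Suc j) * ((1 - q ^ n / (q * q ^ j)) * (1 - k * q ^ n * q ^ j * q))"
      using wp_matrix_Suc_col_q[of "Suc j" n] 3 unfolding c1 c2 by simp
    ultimately show ?thesis
      unfolding add_2_eq_Suc' by (rule eq_times_divideI2) (use nz in simp_all)
  qed (use q_nonzero in simp_all)
qed

lemma beta_weight_Suc:
  assumes "n > 0"
  shows "beta_weight q k (Suc n) = beta_weight q k n *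
    ((1 - k * q\<^sup>2 * (q ^ n)\<^sup>2) * (1 - q ^ n) * (1 - k\<^sup>2 * q ^ n / q) * (1 - q\<^sup>2 * (q ^ n)\<^sup>2)
        / ((1 - k * (q ^ n)\<^sup>2) * (1 - q\<^sup>2 * q ^ n / k) * (1 - k * q * q ^ n) * (1 - k\<^sup>2 * (q ^ n)\<^sup>2)) * (- (q\<^sup>2) / k))"
  using assms beta_coeff_Suc[OF assms] by (simp add: beta_weight_def)

lemma bailey_term_nonzero_conds:
  "1 - k * (q ^ n)\<^sup>2 \<noteq> 0" "1 - k * q\<^sup>2 * (q ^ n)\<^sup>2 \<noteq> 0" "1 - q\<^sup>2 * q ^ n / k \<noteq> 0" "1 - k * q * q ^ n \<noteq> 0"
   "1 - k\<^sup>2 * (q ^ n)\<^sup>2 \<noteq> 0"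
  using k_power_ne_1[of "n + n"] k_power_ne_1[of "n + n + 2"] k_power_ne[of 0 "n + 2"] k_power_ne_1[of "n + 1"]
    k2_power_ne_1[of n] k_nonzero
  unfolding power_add by (simp_all add: power_mult_distrib mult_ac power2_eq_square divide_simps)

text \<open>The row and column ratios have the shape required by \<open>cert_step\<close>. Row
  \<open>0\<close> is excluded because \<open>beta_weight\<close> is set to \<open>0\<close> there
  and breaks the row ratio.\<close>

lemma bailey_term_step:
  assumes "n > 0" "j \<le> n"
  shows "bailey_term q k n (j + 2) - rat_R q k (q ^ j) * bailey_term q k n j
    = bailey_term q k (Suc n) j * cert_g q k (q ^ j) (q ^ Suc n) - bailey_term q k n j * cert_g q k (q ^ j) (q ^ n)"
  unfolding power_Suc
proof (rule cert_step)
  show "1 - q ^ j * q ^ 4 / k\<^sup>2 \<noteq> 0"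
    using k2_ne_power[of "j + 2"] k_nonzero by (auto simp: power_numeral_reduce power_add mult_ac)
  show "1 - q ^ j * q ^ 3 \<noteq> 0" "1 - q ^ n * q ^ j * q\<^sup>2 \<noteq> 0" "1 - q ^ n * q ^ j * q ^ 3 \<noteq> 0"
    using q_power_ne_1[of "j + 3"] q_power_ne_1[of "n + j + 2"] q_power_ne_1[of "n + j + 3"]
    unfolding power_add by (simp_all add: mult_ac)
  show "1 - k * q ^ n / (q\<^sup>2 * q ^ j) \<noteq> 0" "1 - k * q ^ n / (q ^ 3 * q ^ j) \<noteq> 0" "1 - k * q ^ n / (q * q ^ j) \<noteq> 0"
    using k_frac_ne[of n "2 + j"] k_frac_ne[of n "3 + j"] k_frac_ne[of n "1 + j"]
    unfolding power_add by simp_all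
  show "1 - q * q ^ n / q ^ j \<noteq> 0"
    using q_frac_ne_1[of j "Suc n"] assms by simp
  show "bailey_term q k n (j + 2) = bailey_term q k n j *
    ((1 - q ^ n / q ^ j) * (1 - q ^ n / (q * q ^ j)) * (1 - k * q ^ n * q ^ j) * (1 - k * q ^ n * q ^ j * q) /
     ((1 - k * q ^ n / (q\<^sup>2 * q ^ j)) * (1 - k * q ^ n / (q ^ 3 * q ^ j)) * (1 - q ^ n * q ^ j * q\<^sup>2) * (1 - q ^ n * q ^ j * q ^ 3)))"
    unfolding bailey_term_def wp_matrix_col_ratio[OF assms(2)] by (simp only: mult.assoc)
qed (use assms q_nonzero k_nonzero bailey_term_nonzero_conds in
     \<open>simp_all add: bailey_term_def wp_matrix_row_ratio beta_weight_Suc\<close>)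

text \<open>The case \<open>J = 1 / q\<close>, that is \<open>j = -1\<close>: the matrix is invariant under \<open>j \<mapsto> -1 - j\<close>, so its
  column \<open>-1\<close> is its column \<open>0\<close>.\<close>

lemma bailey_term_step_minus_1:
  assumes "n > 0"
  shows "bailey_term q k n 1 - rat_R q k (1 / q) * bailey_term q k n 0
    = bailey_term q k (Suc n) 0 * cert_g q k (1 / q) (q ^ Suc n) - bailey_term q k n 0 * cert_g q k (1 / q) (q ^ n)"
  unfolding power_Suc
proof (rule cert_step)
  show "1 - 1 / q * q ^ 4 / k\<^sup>2 \<noteq> 0"
    using q3_div_k2_ne_1[of 0] q_nonzero by (simp add: power_numeral_reduce)
  show "1 - 1 / q * q ^ 3 \<noteq> 0" "1 - q ^ n * (1 / q) * q\<^sup>2 \<noteq> 0" "1 - q ^ n * (1 / q) * q ^ 3 \<noteq> 0"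
    using q_power_ne_1[of "2"] q_power_ne_1[of "n + 1"] q_power_ne_1[of "n + 2"] q_nonzero by (simp_all add: power_numeral_reduce mult_ac)
  show "1 - k * q ^ n / (q\<^sup>2 * (1 / q)) \<noteq> 0" "1 - k * q ^ n / (q ^ 3 * (1 / q)) \<noteq> 0" "1 - k * q ^ n / (q * (1 / q)) \<noteq> 0"
    using k_frac_ne[of n "1"] k_frac_ne[of n "2"] k_frac_ne[of n "0"] q_nonzero by (simp_all add: power_numeral_reduce)
  show "1 - q * q ^ n / (1 / q) \<noteq> 0"
    using q_power_ne_1[of "n + 2"] assms by (simp add: mult_ac)
  have "wp_matrix q q k n 1 = wp_matrix q q k n 0 * ((1 - q ^ n) * (1 - k * q ^ n) / ((1 - k * q ^ n / q\<^sup>2) * (1 - q ^ n * q\<^sup>2)))"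
  proof -
    have "k / q * q ^ (n - 1) = k * q ^ n / q\<^sup>2"
      using assms q_nonzero by (simp add: power_diff power2_eq_square)
    then have "wp_matrix q q k n 1 * ((1 - k * q ^ n / q\<^sup>2) * (1 - q ^ n * q\<^sup>2)) = wp_matrix q q k n 0 * ((1 - q ^ n) * (1 - k * q ^ n))"
      using wp_matrix_Suc_col_q[of 0 n] assms by (simp add: mult_ac power2_eq_square)
    moreover have "1 - q ^ n * q\<^sup>2 \<noteq> 0"
      using q_power_ne_1[of "n + 2"] unfolding power_add by simp
    ultimately show ?thesis using k_frac_ne[of n 2] by (intro eq_times_divideI) simp_all
  qed
  \<comment> \<open>These two factors occur in both numerator and denominator at
    \<open>J = 1 / q\<close>. Cancelling them reduces the double column step from \<open>-1\<close>
    to the single step from \<open>0\<close> to \<open>1\<close>.\<close>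
  moreover have "1 - q ^ n * q \<noteq> 0" "1 - k * q ^ n / q \<noteq> 0"
    using q_power_ne_1[of "n + 1"] k_frac_ne[of n 1] by (simp_all add: mult.commute)
  ultimately show "bailey_term q k n 1 = bailey_term q k n 0 *
    ((1 - q ^ n / (1 / q)) * (1 - q ^ n / (q * (1 / q))) * (1 - k * q ^ n * (1 / q)) * (1 - k * q ^ n * (1 / q) * q) /
     ((1 - k * q ^ n / (q\<^sup>2 * (1 / q))) * (1 - k * q ^ n / (q ^ 3 * (1 / q))) * (1 - q ^ n * (1 / q) * q\<^sup>2) * (1 - q ^ n * (1 / q) * q ^ 3)))"
    using q_nonzero by (simp add: bailey_term_def power_numeral_reduce)
  have "wp_matrix q q k (Suc n) 0 = wp_matrix q q k n 0 * ((1 - k * q ^ n / q) * (1 - k * q ^ n) / ((1 - q * q ^ n) * (1 - q ^ n * q\<^sup>2)))"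
    using wp_matrix_row_ratio[of 0 n] by simp
  then show "bailey_term q k (Suc n) 0 = bailey_term q k n 0 *
    ((1 - k * q\<^sup>2 * (q ^ n)\<^sup>2) * (1 - q ^ n) * (1 - k\<^sup>2 * q ^ n / q) * (1 - q\<^sup>2 * (q ^ n)\<^sup>2) /
     ((1 - k * (q ^ n)\<^sup>2) * (1 - q\<^sup>2 * q ^ n / k) * (1 - k * q * q ^ n) * (1 - k\<^sup>2 * (q ^ n)\<^sup>2)) * (- q\<^sup>2 / k) *
     ((1 - k * q ^ n / (q * (1 / q))) * (1 - k * q ^ n * (1 / q)) / ((1 - q * q ^ n / (1 / q)) * (1 - q ^ n * (1 / q) * q\<^sup>2))))"
    using q_nonzero assms by (simp add: bailey_term_def beta_weight_Suc power_numeral_reduce mult_ac)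
qed (use assms q_nonzero k_nonzero bailey_term_nonzero_conds in simp_all)

end
end

section \<open>Evaluation of the column sums\<close>

text \<open>Parameters and indices all depend on \<open>x\<close>, so the same bound covers a fixed
  \<open>k\<close> with varying indices and, with \<open>a\<close> and \<open>k\<close> exchanged,
  the inverse matrix uniformly for \<open>k\<close> in a compact set.\<close>

lemma bounded_wp_matrix:
  assumes q: "norm q < 1" "\<And>m. q * q ^ m \<noteq> 1"
    and b: "bounded ((\<lambda>x. k x / a x) ` A)" "bounded (k ` A)" "compact ((\<lambda>x. a x * q) ` A)"
    and nz: "\<And>x m. x \<in> A \<Longrightarrow> a x * q * q ^ m \<noteq> 1"
  shows "bounded ((\<lambda>x. wp_matrix q (a x) (k x) (n x) (j x)) ` A)"
proof -
  have c: "compact ((\<lambda>x. q) ` A)" by (simp add: image_constant_conv)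
  have "bounded ((\<lambda>x. qpoch (k x / a x) q (n x - j x) * qpoch (k x) q (n x + j x) *
      (inverse (qpoch q q (n x - j x)) * inverse (qpoch (a x * q) q (n x + j x)))) ` A)"
    by (intro bounded_image_mult bounded_qpoch bounded_inverse_qpoch q b nz c)
  then obtain B where B: "\<And>x. x \<in> A \<Longrightarrow> norm (qpoch (k x / a x) q (n x - j x) * qpoch (k x) q (n x + j x) *
      (inverse (qpoch q q (n x - j x)) * inverse (qpoch (a x * q) q (n x + j x)))) \<le> B"
    unfolding bounded_iff by blast
  have "norm (wp_matrix q (a x) (k x) (n x) (j x)) \<le> max B 0" if "x \<in> A" for x
    using B[OF that] by (auto simp: wp_matrix_def divide_inverse)
  then show ?thesis unfolding bounded_iff by blast
qed

context
  fixes q :: complex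
  assumes q: "0 < norm q" "norm q < 1"
begin

context
  fixes k :: complex
  assumes k: "admissible q k"
begin

lemmas base_facts = q q_nonzero[OF q] k_nonzero[OF q k] norm_q2[OF q]

lemma bounded_beta_coeff: "bounded (range (beta_coeff q k))"
proof -
  have "bounded (range (\<lambda>n. (1 - k * q ^ (2 * n))))"
  proof -
    have "(\<lambda>n. q ^ (2 * n)) \<longlonglongrightarrow> 0"
      using LIMSEQ_power_zero[OF base_facts(5)] by (simp add: power_mult)
    then have "(\<lambda>n. 1 - k * q ^ (2 * n)) \<longlonglongrightarrow> 1 - k * 0"
      by (intro tendsto_intros)
    then show ?thesis by (rule convergent_imp_bounded)
  qed
  then have "bounded (range (\<lambda>n. (1 - k * q ^ (2 * n)) * qpoch q q (n - 1) * qpoch (k^2 / q) q n * qpoch (q^2) (q^2) n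
     * (inverse (1 - k) * (inverse (qpoch (q^2 / k) q n) * inverse (qpoch (k * q) q n)) * inverse (qpoch (k^2) (q^2) n))))"
    using k_power_ne_1[OF q k] q2_div_k_power_ne_1[OF q k] k2_power_ne_1[OF q k]
    by (intro bounded_image_mult bounded_qpoch bounded_inverse_qpoch base_facts)
       (auto simp: image_constant_conv mult.assoc power_Suc[symmetric] simp del: power_Suc)
  then show ?thesis
    by (simp add: beta_coeff_def[abs_def] divide_inverse mult.assoc)
qed

lemma bounded_wp_matrix_q: "bounded (range (\<lambda>x. wp_matrix q q k (n x) (j x)))"
  using q_power_ne_1[OF q, of "_ + 2"] q_power_ne_1[OF q, of "_ + 1"]
  by (intro bounded_wp_matrix) (auto simp: q image_constant_conv mult_ac)

lemma beta_coeff_convergent: "convergent (beta_coeff q k)"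
proof -
  have 1: "(\<lambda>n. q ^ (2 * n)) \<longlonglongrightarrow> 0"
    using LIMSEQ_power_zero[OF base_facts(5)] by (simp add: power_mult)
  have "(\<lambda>n. qpoch q q (Suc n - 1)) \<longlonglongrightarrow> qpoch_inf q q"
    using qpoch_LIMSEQ[OF q(2)] by simp
  then have 2: "(\<lambda>n. qpoch q q (n - 1)) \<longlonglongrightarrow> qpoch_inf q q"
    by (simp only: filterlim_sequentially_Suc[of "\<lambda>n. qpoch q q (n - 1)"])
  have nz: "(1 - k) * (qpoch_inf (q^2 / k) q * qpoch_inf (k * q) q) * qpoch_inf (k^2) (q^2) \<noteq> 0"
    using k_power_ne_1[OF q k, of 0] k_power_ne_1[OF q k, of "Suc _"] q2_div_k_power_ne_1[OF q k] k2_power_ne_1[OF q k]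
    by (auto simp: qpoch_inf_eq_0_iff base_facts mult.assoc)
  have "beta_coeff q k \<longlonglongrightarrow> (1 - k * 0) * qpoch_inf q q * qpoch_inf (k^2 / q) q * qpoch_inf (q^2) (q^2)
     / ((1 - k) * (qpoch_inf (q^2 / k) q * qpoch_inf (k * q) q) * qpoch_inf (k^2) (q^2))"
    unfolding beta_coeff_def[abs_def]
    by (intro tendsto_intros 1 2 qpoch_LIMSEQ base_facts nz)
  then show ?thesis by (rule convergentI)
qed

lemma wp_matrix_diagonal_convergent: "convergent (\<lambda>j. wp_matrix q q k (m + j) j)"
proof -
  have f: "(\<lambda>j. qpoch x q (m + j + j)) \<longlonglongrightarrow> qpoch_inf x q" for x
    using LIMSEQ_subseq_LIMSEQ[OF qpoch_LIMSEQ[OF q(2), of x], of "\<lambda>j. m + j + j"]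
    by (simp add: strict_mono_def o_def)
  have nz: "qpoch q q m * qpoch_inf (q * q) q \<noteq> 0"
    using q_power_ne_1[OF q, of "_ + 2"] q_power_ne_1[OF q, of "_ + 1"]
    by (auto simp: qpoch_inf_eq_0_iff qpoch_eq_0_iff q mult.assoc)
  have "(\<lambda>j. qpoch (k / q) q m * qpoch k q (m + j + j) / (qpoch q q m * qpoch (q * q) q (m + j + j)))
     \<longlonglongrightarrow> qpoch (k / q) q m * qpoch_inf k q / (qpoch q q m * qpoch_inf (q * q) q)"
    by (intro tendsto_intros f nz)
  then have "(\<lambda>j. wp_matrix q q k (m + j) j)
     \<longlonglongrightarrow> qpoch (k / q) q m * qpoch_inf k q / (qpoch q q m * qpoch_inf (q * q) q)"
    by (simp add: wp_matrix_def)
  then show ?thesis by (rule convergentI)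
qed

lemma cert_g_convergent: "convergent (\<lambda>n. cert_g q k J (q ^ n))"
proof -
  have lim: "(\<lambda>n. 1 - c * q ^ n) \<longlonglongrightarrow> 1" "(\<lambda>n. 1 - c * (q ^ n)\<^sup>2) \<longlonglongrightarrow> 1" for c
    using tendsto_diff[OF tendsto_const tendsto_mult[OF tendsto_const q_power_LIMSEQ[OF q]], of 1 c]
      tendsto_diff[OF tendsto_const tendsto_mult[OF tendsto_const tendsto_power[OF q_power_LIMSEQ[OF q]]], of 1 c 2]
    by simp_all
  have eq: "cert_g q k J (q ^ n) = cert_p q k J * (1 - q / k * q ^ n) * (1 - k * q ^ n) * (1 - k\<^sup>2 / q\<^sup>2 * (q ^ n)\<^sup>2) * (1 - 1 / J * q ^ n)
     / ((1 - k * (q ^ n)\<^sup>2) * (1 - k / (q\<^sup>2 * J) * q ^ n) * (1 - k / (q ^ 3 * J) * q ^ n) * (1 - J * q\<^sup>2 * q ^ n))" for n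
    by (simp add: cert_g_def mult_ac)
  have "(\<lambda>n. cert_g q k J (q ^ n)) \<longlonglongrightarrow> cert_p q k J * 1 * 1 * 1 * 1 / (1 * 1 * 1 * 1)"
    unfolding eq by (rule tendsto_divide tendsto_mult tendsto_const lim)+ simp
  then show ?thesis by (rule convergentI)
qed

context
  assumes kq: "norm (q\<^sup>2) < norm k"
begin

abbreviation (input) "r \<equiv> - (q\<^sup>2) / k"

lemma norm_r: "norm r < 1"
  using kq k_nonzero[OF q k] by (simp add: norm_divide divide_less_eq)

lemma bailey_term_bound: "\<exists>C. \<forall>n j. norm (bailey_term q k n j) \<le> C * norm r ^ n"
proof -
  obtain B where B: "\<And>n. norm (beta_coeff q k n) \<le> B"
    using bounded_beta_coeff by (auto simp: bounded_iff)
  obtain D where D: "\<And>n j. norm (wp_matrix q q k n j) \<le> D"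
    using bounded_wp_matrix_q[of fst snd] by (auto simp: bounded_iff)
  have B0: "0 \<le> B" using B[of 0] norm_ge_zero order_trans by blast
  have "norm (bailey_term q k n j) \<le> B * D * norm r ^ n" for n j
  proof -
    have "norm (beta_weight q k n) \<le> B * norm r ^ n"
      using B[of n] B0 by (auto simp: beta_weight_def norm_mult norm_power intro!: mult_right_mono)
    then have "norm (bailey_term q k n j) \<le> (B * norm r ^ n) * D"
      unfolding bailey_term_def norm_mult using D[of n j] B0 by (intro mult_mono) auto
    then show ?thesis by (simp add: mult_ac)
  qed
  then show ?thesis by blast
qed

lemma summable_bailey_term: "summable (\<lambda>n. bailey_term q k n j)"
proof -
  obtain C where "\<And>n. norm (bailey_term q k n j) \<le> C * norm r ^ n"
    using bailey_term_bound by blast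
  then show ?thesis
    using norm_r
    by (intro summable_comparison_test'[OF summable_mult[OF summable_geometric[of "norm r"], of C], of 0]) simp_all
qed

lemma cert_g_tendsto_0: "(\<lambda>n. bailey_term q k n j * cert_g q k J (q ^ n)) \<longlonglongrightarrow> 0"
proof -
  obtain c where "(\<lambda>n. cert_g q k J (q ^ n)) \<longlonglongrightarrow> c"
    using cert_g_convergent by (auto simp: convergent_def)
  from tendsto_mult[OF summable_LIMSEQ_zero[OF summable_bailey_term] this]
  show ?thesis by simp
qed

lemma bailey_term_gt: "n < j \<Longrightarrow> bailey_term q k n j = 0"
  by (simp add: bailey_term_def)

text \<open>Summation starts at \<open>n = j\<close>, where the boundary term vanishes through the
  factor \<open>1 - X / J\<close>.\<close>

lemma column_sum_step:
  assumes "j > 0"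
  shows "column_sum q k (j + 2) = rat_R q k (q ^ j) * column_sum q k j"
proof -
  have "column_sum q k (j + 2) = rat_R q k (q ^ j) * column_sum q k j - bailey_term q k j j * cert_g q k (q ^ j) (q ^ j)"
    unfolding column_sum_def
    by (rule suminf_telescope[where G = "\<lambda>n. bailey_term q k n j * cert_g q k (q ^ j) (q ^ n)"])
       (use assms bailey_term_step[OF q k] cert_g_tendsto_0 in \<open>auto simp: summable_bailey_term bailey_term_gt\<close>)
  then show ?thesis using q_nonzero[OF q] by (simp add: cert_g_def)
qed

lemma bailey_term_0 [simp]: "bailey_term q k 0 j = 0"
  by (simp add: bailey_term_def beta_weight_def)

lemma bailey_term_1_0:
  "bailey_term q k 1 0 = (1 - k * q\<^sup>2) * (1 - k\<^sup>2 / q) * r * (1 - k / q) / ((1 - q\<^sup>2 / k) * (1 - k * q) * (1 - k\<^sup>2) * (1 - q))"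
  using q_power_ne_1[OF q, of 2] k_power_ne_1[OF q k, of 0]
  by (simp add: bailey_term_def beta_weight_def beta_coeff_def wp_matrix_def qpoch_def power2_eq_square mult_ac)

lemma cert_g_factors_nonzero:
  "1 - k * q\<^sup>2 \<noteq> 0" "1 - k / q \<noteq> 0" "1 - q\<^sup>2 / k \<noteq> 0" "1 - k * q \<noteq> 0" "1 - k\<^sup>2 \<noteq> 0" "1 - q \<noteq> 0"
  "1 - k \<noteq> 0" "1 - q\<^sup>2 \<noteq> 0" "1 - q ^ 3 \<noteq> 0" "k - q\<^sup>2 \<noteq> 0" "1 - q ^ 4 / k\<^sup>2 \<noteq> 0" "1 - q ^ 3 / k\<^sup>2 \<noteq> 0" "k\<^sup>2 - q\<^sup>2 \<noteq> 0"
  using k_power_ne_1[OF q k, of 2] k_div_q_power_ne_1[OF q k, of 0] q2_div_k_power_ne_1[OF q k, of 0]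
    k_power_ne_1[OF q k, of 1] k2_power_ne_1[OF q k, of 0] q_power_ne_1[OF q, of 1] k_power_ne_1[OF q k, of 0]
    q_power_ne_1[OF q, of 2] q_power_ne_1[OF q, of 3] k_power_ne[OF q k, of 0 2]
    q4_div_k2_ne_1[OF q k, of 0] q3_div_k2_ne_1[OF q k, of 0] k2_ne_power[OF q k, of 0, unfolded add_0]
  by simp_all

text \<open>\<open>rat_R\<close> vanishes at \<open>J = 1\<close>, so column \<open>0\<close> drops
  out. Summation starts only at \<open>n = 1\<close>, where \<open>1 - X / J\<close> is not
  \<open>0\<close>; the boundary term there is the whole value.\<close>

lemma column_sum_2: "column_sum q k 2 = even_coeff q k 0 * r\<^sup>2"
proof -
  have "column_sum q k (0 + 2) = rat_R q k (q ^ 0) * column_sum q k 0 - bailey_term q k 1 0 * cert_g q k (q ^ 0) (q ^ 1)"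
    unfolding column_sum_def
    by (rule suminf_telescope[where G = "\<lambda>n. bailey_term q k n 0 * cert_g q k (q ^ 0) (q ^ n)"])
       (use bailey_term_step[OF q k, of _ 0] cert_g_tendsto_0[of 0 "q ^ 0"] in \<open>auto simp: summable_bailey_term\<close>)
  then have *: "column_sum q k 2 = - bailey_term q k 1 0 * cert_g q k 1 q"
    by (simp add: rat_R_def numeral_2_eq_2)
  have g: "cert_g q k 1 q = - (k - q\<^sup>2) / (k * (1 - q ^ 4 / k\<^sup>2)) * (1 - q\<^sup>2 / k) * (1 - k * q) * (1 - k\<^sup>2) * (1 - q)
     / ((1 - k * q\<^sup>2) * (1 - k / q) * ((q\<^sup>2 - k) / q\<^sup>2) * (1 - q ^ 3))"
    using q_nonzero[OF q] cert_g_factors_nonzero(9)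
    by (simp add: cert_g_def cert_p_def diff_divide_distrib power2_eq_square power3_eq_cube mult_ac)
  \<comment> \<open>A denominator factor of the certificate becomes \<open>(q^2 - k) / q^2\<close>
    here and cancels the factor \<open>k - q^2\<close> of \<open>cert_p\<close>. Naming it keeps the
    cancellation visible to the simplifier.\<close>
  define t \<rho> where "t = q\<^sup>2 - k" and "\<rho> = r"
  have t: "k - q\<^sup>2 = - t" "t \<noteq> 0" using cert_g_factors_nonzero(10) by (auto simp: t_def)
  have g': "cert_g q k 1 q = q\<^sup>2 / (k * (1 - q ^ 4 / k\<^sup>2)) * (1 - q\<^sup>2 / k) * (1 - k * q) * (1 - k\<^sup>2) * (1 - q)
     / ((1 - k * q\<^sup>2) * (1 - k / q) * (1 - q ^ 3))"
    unfolding g t(1) t_def[symmetric] using t(2) by (simp add: mult_ac)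
  \<comment> \<open>Letters stand for the nonzero factors, so that they cancel without being
    multiplied out.\<close>
  have "- (y1 * b * \<rho> * y2 / (y3 * y4 * y5 * y6)) * (q\<^sup>2 / (k * n) * y3 * y4 * y5 * y6 / (y1 * y2 * m))
      = - b * \<rho> * q\<^sup>2 / (k * n * m)"
    if "y1 \<noteq> 0" "y2 \<noteq> 0" "y3 \<noteq> 0" "y4 \<noteq> 0" "y5 \<noteq> 0" "y6 \<noteq> 0"
    for y1 y2 y3 y4 y5 y6 b n m
    using that by (simp add: mult_ac)
  from this[OF cert_g_factors_nonzero(1-6)]
  have "column_sum q k 2 = - (1 - k\<^sup>2 / q) * \<rho> * q\<^sup>2 / (k * (1 - q ^ 4 / k\<^sup>2) * (1 - q ^ 3))"
    unfolding * bailey_term_1_0 g' \<rho>_def .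
  moreover have "- x * r * q\<^sup>2 / (k * n * m) = x / (n * m) * r\<^sup>2" for x n m
    by (simp add: power2_eq_square mult_ac)
  ultimately show ?thesis
    by (simp only: \<rho>_def) (simp add: even_coeff_def qpoch_def)
qed

text \<open>The telescoping at \<open>J = 1 / q\<close>, again from \<open>n = 1\<close>: column
  \<open>-1\<close> equals column \<open>0\<close>, and the boundary term is \<open>rat_R\<close>
  times \<open>pole_term\<close>.\<close>

lemma column_sum_1: "column_sum q k 1 = rat_R q k (1 / q) * (column_sum q k 0 + pole_term q k)"
proof -
  have *: "column_sum q k 1 = rat_R q k (1 / q) * column_sum q k 0 - bailey_term q k 1 0 * cert_g q k (1 / q) (q ^ 1)"
    unfolding column_sum_def
    by (rule suminf_telescope[where G = "\<lambda>n. bailey_term q k n 0 * cert_g q k (1 / q) (q ^ n)"])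
       (use bailey_term_step_minus_1[OF q k] cert_g_tendsto_0[of 0 "1 / q"] in \<open>auto simp: summable_bailey_term\<close>)
  have g: "cert_g q k (1 / q) q = - (k - q\<^sup>2) * (1 - q) / (k * (1 - q ^ 3 / k\<^sup>2) * (1 - q\<^sup>2)) * (1 - q\<^sup>2 / k) * (1 - k * q) * (1 - k\<^sup>2)
     / ((1 - k * q\<^sup>2) * (1 - k) * (1 - k / q))"
    using q_nonzero[OF q] cert_g_factors_nonzero(8)
    by (simp add: cert_g_def cert_p_def power2_eq_square power_numeral_reduce mult_ac)
  have R: "rat_R q k (1 / q) * pole_term q k = q * (k\<^sup>2 - q) * (k - q\<^sup>2) / ((1 - q ^ 3 / k\<^sup>2) * (1 - q\<^sup>2) * k\<^sup>2 * (1 - k))"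
  proof -
    have f: "(1 - 1 / q) * (1 - k\<^sup>2 * (1 / q) / q) * q ^ 4 = q * (1 - q) * (k\<^sup>2 - q\<^sup>2)"
      using q_nonzero[OF q] by (simp add: field_simps power_numeral_reduce power2_eq_square)
    have f2: "1 / q * q ^ 4 = q ^ 3" "1 / q * q ^ 3 = q\<^sup>2"
      using q_nonzero[OF q] by (simp_all add: power_numeral_reduce)
    show ?thesis
      unfolding rat_R_def pole_term_def f f2 using cert_g_factors_nonzero by (simp add: mult.assoc)
  qed
  have b: "1 - k\<^sup>2 / q = (q - k\<^sup>2) / q" using q_nonzero[OF q] by (simp add: field_simps)
  have "- (y1 * ((q - k\<^sup>2) / q) * r * y2 / (y3 * y4 * y5 * y6)) * (- (k - q\<^sup>2) * y6 / (k * n * m) * y3 * y4 * y5 / (y1 * d * y2))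
      = q * (k\<^sup>2 - q) * (k - q\<^sup>2) / (n * m * k\<^sup>2 * d)"
    if "y1 \<noteq> 0" "y2 \<noteq> 0" "y3 \<noteq> 0" "y4 \<noteq> 0" "y5 \<noteq> 0" "y6 \<noteq> 0" "n \<noteq> 0" "m \<noteq> 0" "d \<noteq> 0"
    for y1 y2 y3 y4 y5 y6 n m d
    using that q_nonzero[OF q] k_nonzero[OF q k]
    by (simp add: power2_eq_square divide_simps) (simp add: algebra_simps)
  from this[OF cert_g_factors_nonzero(1-6,12,8,7)]
  have "- bailey_term q k 1 0 * cert_g q k (1 / q) q = rat_R q k (1 / q) * pole_term q k"
    unfolding bailey_term_1_0 g R b .
  then show ?thesis unfolding * power_one_right distrib_left by simp
qed

lemma column_sum_even: "column_sum q k (2 * n + 2) = even_coeff q k n * r ^ (2 * n + 2)"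
proof (induction n)
  case 0
  then show ?case using column_sum_2 by (simp add: numeral_2_eq_2)
next
  case (Suc n)
  have e: "2 * Suc n + 2 = 2 * n + 4" "2 * n + 2 + 2 = 2 * n + 4" by simp_all
  show ?case
    using column_sum_step[of "2 * n + 2"] even_coeff_Suc[OF q k, of n] Suc unfolding e by simp
qed

text \<open>Since \<open>rat_R\<close> does not vanish at \<open>J = 1 / q\<close>, the telescoping
  fixes the odd columns only up to a common factor that contains the unknown column
  \<open>0\<close>.\<close>

lemma column_sum_odd:
  "column_sum q k (2 * n + 1) = (column_sum q k 0 + pole_term q k) * odd_coeff q k n * r ^ (2 * n + 2)"
proof (induction n)
  case 0
  have e: "2 * 0 + 1 = (1::nat)" "2 * 0 + 2 = (2::nat)" by simp_all
  show ?case unfolding e column_sum_1 odd_coeff_0[OF q k, symmetric] by (simp only: mult_ac)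
next
  case (Suc n)
  have e: "2 * Suc n + 2 = 2 * n + 4" "2 * Suc n + 1 = 2 * n + 1 + 2" by simp_all
  have "column_sum q k (2 * n + 1 + 2) = rat_R q k (q ^ (2 * n + 1)) * column_sum q k (2 * n + 1)"
    using column_sum_step[of "2 * n + 1"] by simp
  then show ?case unfolding e mult.assoc odd_coeff_Suc[OF q k, of n] Suc
    by (simp only: mult_ac)
qed

text \<open>With \<open>n = m + j\<close> the power \<open>r ^ j\<close> splits off and the
  remaining summand converges in \<open>j\<close> for fixed \<open>m\<close>, dominated by a
  multiple of \<open>norm r ^ m\<close>; Tannery's theorem gives the limit.\<close>

lemma column_sum_convergent: "convergent (\<lambda>j. column_sum q k j / r ^ j)"
proof -
  define a where "a m j = beta_coeff q k (m + j) * r ^ m * wp_matrix q q k (m + j) j" for m j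
  have r0: "r \<noteq> 0" using q_nonzero[OF q] k_nonzero[OF q k] by simp
  obtain b where b: "\<And>m. (\<lambda>j. a m j) \<longlonglongrightarrow> b m"
  proof -
    obtain c where c: "beta_coeff q k \<longlonglongrightarrow> c"
      using beta_coeff_convergent by (auto simp: convergent_def)
    have "convergent (a m)" for m
    proof -
      obtain d where "(\<lambda>j. wp_matrix q q k (m + j) j) \<longlonglongrightarrow> d"
        using wp_matrix_diagonal_convergent by (auto simp: convergent_def)
      moreover have "(\<lambda>j. beta_coeff q k (m + j)) \<longlonglongrightarrow> c"
        using LIMSEQ_ignore_initial_segment[OF c, of m] by (simp add: add.commute)
      ultimately have "(\<lambda>j. beta_coeff q k (m + j) * r ^ m * wp_matrix q q k (m + j) j) \<longlonglongrightarrow> c * r ^ m * d"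
        by (intro tendsto_mult tendsto_const)
      then show ?thesis
        unfolding a_def by (rule convergentI)
    qed
    then show ?thesis using that unfolding convergent_def by metis
  qed
  obtain B where B: "\<And>n. norm (beta_coeff q k n) \<le> B"
    using bounded_beta_coeff by (auto simp: bounded_iff)
  obtain D where D: "\<And>n j. norm (wp_matrix q q k n j) \<le> D"
    using bounded_wp_matrix_q[of fst snd] by (auto simp: bounded_iff)
  have B0: "0 \<le> B" using B[of 0] norm_ge_zero order_trans by blast
  have bd: "norm (a m j) \<le> B * D * norm r ^ m" for m j
  proof -
    have "norm (a m j) \<le> (B * norm r ^ m) * D"
      unfolding a_def norm_mult norm_power using B[of "m + j"] D[of "m + j" j] B0
      by (intro mult_mono) auto
    then show ?thesis by (simp add: mult_ac)
  qed
  have "(\<lambda>j. \<Sum>m. a m j) \<longlonglongrightarrow> suminf b"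
    by (rule conjunct2[OF conjunct2[OF tannerys_theorem[where M = "\<lambda>m. B * D * norm r ^ m"]]])
       (use b bd norm_r in \<open>auto intro!: summable_mult summable_geometric always_eventually\<close>)
  \<comment> \<open>At \<open>j = 0\<close>, \<open>m = 0\<close> the term \<open>a m j\<close>
    contains \<open>beta_coeff\<close> where \<open>bailey_term\<close> is \<open>0\<close>; the
    equality needs \<open>j > 0\<close>.\<close>
  moreover have "eventually (\<lambda>j. (\<Sum>m. a m j) = column_sum q k j / r ^ j) sequentially"
    using eventually_gt_at_top[of 0]
  proof eventually_elim
    case (elim j)
    have "column_sum q k j = (\<Sum>m. bailey_term q k (m + j) j)"
      unfolding column_sum_def
      using suminf_split_initial_segment[OF summable_bailey_term, of j j] by (simp add: bailey_term_def)
    also have "\<dots> = (\<Sum>m. r ^ j * a m j)"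
      using elim by (intro suminf_cong) (simp add: bailey_term_def beta_weight_def a_def power_add mult_ac)
    also have "\<dots> = r ^ j * (\<Sum>m. a m j)"
    proof (rule suminf_mult)
      show "summable (\<lambda>m. a m j)"
        using bd norm_r
        by (intro summable_comparison_test'[OF summable_mult[OF summable_geometric[of "norm r"], of "B * D"], of 0]) simp_all
    qed
    finally show ?case using r0 by simp
  qed
  ultimately have "(\<lambda>j. column_sum q k j / r ^ j) \<longlonglongrightarrow> suminf b"
    by (rule Lim_transform_eventually)
  then show ?thesis by (rule convergentI)
qed

text \<open>The even columns give the common limit explicitly, the odd ones give it as a known
  nonzero multiple of \<open>S\<close>; dividing yields the infinite products.\<close>

lemma column_sum_0: "column_sum q k 0 + pole_term q k = theta_quot q k"
proof -
  define S where "S = column_sum q k 0 + pole_term q k"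
  have r0: "r \<noteq> 0" using q_nonzero[OF q] k_nonzero[OF q k] by simp
  define P where "P x = qpoch_inf x (q\<^sup>2)" for x
  have P: "(\<lambda>n. qpoch x (q\<^sup>2) n) \<longlonglongrightarrow> P x" "(\<lambda>n. qpoch x (q\<^sup>2) (Suc n)) \<longlonglongrightarrow> P x" for x
    using qpoch_LIMSEQ[OF base_facts(5)] LIMSEQ_Suc unfolding P_def by blast+
  have nz: "P (q ^ 4 / k\<^sup>2) \<noteq> 0" "P (q ^ 3) \<noteq> 0" "P (q ^ 3 / k\<^sup>2) \<noteq> 0" "P (q\<^sup>2) \<noteq> 0" "P (k\<^sup>2) \<noteq> 0"
    using q4_div_k2_ne_1[OF q k] q3_div_k2_ne_1[OF q k] q_power_mult_ne_1[OF q k, of 3] q_power_mult_ne_1[OF q k, of 2] k2_power_ne_1[OF q k]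
    by (auto simp: P_def qpoch_inf_eq_0_iff base_facts)
  have E: "even_coeff q k \<longlonglongrightarrow> P (q\<^sup>2) * P (k\<^sup>2 / q) / (P (q ^ 4 / k\<^sup>2) * P (q ^ 3))"
    unfolding even_coeff_def[abs_def] using nz by (intro tendsto_intros P) auto
  have O: "odd_coeff q k \<longlonglongrightarrow> P (k\<^sup>2 / q\<^sup>2) * P (1 / q) / (P (q ^ 3 / k\<^sup>2) * P (q\<^sup>2))"
    unfolding odd_coeff_def[abs_def] using nz by (intro tendsto_intros P) auto
  obtain L where L: "(\<lambda>j. column_sum q k j / r ^ j) \<longlonglongrightarrow> L"
    using column_sum_convergent by (auto simp: convergent_def)
  have "(\<lambda>n. column_sum q k (2 * n + 2) / r ^ (2 * n + 2)) \<longlonglongrightarrow> L"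
    using LIMSEQ_subseq_LIMSEQ[OF L, of "\<lambda>n. 2 * n + 2"] by (simp add: strict_mono_def o_def)
  moreover have "column_sum q k (2 * n + 2) / r ^ (2 * n + 2) = even_coeff q k n" for n
    unfolding column_sum_even using r0 by simp
  ultimately have 1: "even_coeff q k \<longlonglongrightarrow> L" by simp
  have "(\<lambda>n. column_sum q k (2 * n + 1) / r ^ (2 * n + 1)) \<longlonglongrightarrow> L"
    using LIMSEQ_subseq_LIMSEQ[OF L, of "\<lambda>n. 2 * n + 1"] by (simp add: strict_mono_def o_def)
  moreover have "column_sum q k (2 * n + 1) / r ^ (2 * n + 1) = S * odd_coeff q k n * r" for n
  proof -
    have "x * c ^ (2 * n + 2) / c ^ (2 * n + 1) = x * c" if "c \<noteq> 0" for x c :: complex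
      using that by simp
    from this[OF r0] show ?thesis
      unfolding column_sum_odd S_def[symmetric] .
  qed
  ultimately have "(\<lambda>n. S * odd_coeff q k n * r) \<longlonglongrightarrow> L" by simp
  moreover have "(\<lambda>n. S * odd_coeff q k n * r) \<longlonglongrightarrow> S * (P (k\<^sup>2 / q\<^sup>2) * P (1 / q) / (P (q ^ 3 / k\<^sup>2) * P (q\<^sup>2))) * r"
    by (intro tendsto_mult tendsto_const O)
  ultimately have eq: "S * (P (k\<^sup>2 / q\<^sup>2) * P (1 / q) / (P (q ^ 3 / k\<^sup>2) * P (q\<^sup>2))) * r
     = P (q\<^sup>2) * P (k\<^sup>2 / q) / (P (q ^ 4 / k\<^sup>2) * P (q ^ 3))"
    using LIMSEQ_unique E 1 by metis
  have shift: "P x = (1 - x) * P (x * q\<^sup>2)" for x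
    unfolding P_def by (rule qpoch_inf_shift[OF base_facts(5)])
  \<comment> \<open>Base \<open>q^2\<close> shifts bring the products from the two limits and those
    of the theorem to the six common ones named \<open>A\<close> to \<open>H\<close> below.
    \<open>1 / q\<close> needs two shifts to reach \<open>q ^ 3\<close>.\<close>
  have s: "P (k\<^sup>2 / q) = (1 - k\<^sup>2 / q) * P (k\<^sup>2 * q)" "P (q / k\<^sup>2) = (1 - q / k\<^sup>2) * P (q ^ 3 / k\<^sup>2)"
    "P (q\<^sup>2 / k\<^sup>2) = (1 - q\<^sup>2 / k\<^sup>2) * P (q ^ 4 / k\<^sup>2)" "P (k\<^sup>2 / q\<^sup>2) = (1 - k\<^sup>2 / q\<^sup>2) * P (k\<^sup>2)"
    "P q = (1 - q) * P (q ^ 3)" "P (1 / q) = (1 - 1 / q) * ((1 - q) * P (q ^ 3))"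
    using shift[of "k\<^sup>2 / q"] shift[of "q / k\<^sup>2"] shift[of "q\<^sup>2 / k\<^sup>2"] shift[of "k\<^sup>2 / q\<^sup>2"] shift[of q] shift[of "1 / q"] q_nonzero[OF q]
    by (simp_all add: power2_eq_square power_numeral_reduce mult_ac)
  have nz2: "k\<^sup>2 \<noteq> q\<^sup>2" "q \<noteq> 1" "q \<noteq> 0" "k \<noteq> 0"
    using k2_ne_power[OF q k, of 0, unfolded add_0] q base_facts by auto
  define A B C D F H where ABC: "A = P (k\<^sup>2 * q)" "B = P (q ^ 3 / k\<^sup>2)" "C = P (q\<^sup>2)" "D = P (q ^ 4 / k\<^sup>2)" "F = P (q ^ 3)" "H = P (k\<^sup>2)"
  have nzA: "B \<noteq> 0" "C \<noteq> 0" "D \<noteq> 0" "F \<noteq> 0" "H \<noteq> 0" using nz by (simp_all add: ABC)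
  have eq': "S * ((1 - k\<^sup>2 / q\<^sup>2) * H * ((1 - 1 / q) * ((1 - q) * F)) / (B * C)) * r = C * ((1 - k\<^sup>2 / q) * A) / (D * F)"
    using eq unfolding s ABC by simp
  have "theta_quot q k = k * (A * ((1 - q / k\<^sup>2) * B) * C * C / (H * ((1 - q\<^sup>2 / k\<^sup>2) * D) * ((1 - q) * F) * ((1 - q) * F)))"
    unfolding theta_quot_def qpochs_inf_def by (simp add: P_def[symmetric] s ABC mult.assoc)
  also have "\<dots> = S"
  proof -
    \<comment> \<open>The coefficient of \<open>S\<close> in \<open>eq'\<close>. It is nonzero, so
      it suffices to compare both sides after multiplication by it.\<close>
    define X where "X = ((1 - k\<^sup>2 / q\<^sup>2) * H * ((1 - 1 / q) * ((1 - q) * F)) / (B * C)) * r"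
    have f: "1 - k\<^sup>2 / q = - (k\<^sup>2 / q) * (1 - q / k\<^sup>2)" "1 - q\<^sup>2 / k\<^sup>2 = - (q\<^sup>2 / k\<^sup>2) * (1 - k\<^sup>2 / q\<^sup>2)"
      "1 - 1 / q = - (1 - q) / q" "1 - k\<^sup>2 / q\<^sup>2 \<noteq> 0" "1 - q \<noteq> 0"
      using nz2 by (simp_all add: field_simps)
    have "1 - 1 / q \<noteq> 0" using nz2 by simp
    then have X: "X \<noteq> 0" unfolding X_def using nzA nz2(3,4) f(4,5) by simp
    have "k * (A * ((1 - q / k\<^sup>2) * B) * C * C / (H * ((1 - q\<^sup>2 / k\<^sup>2) * D) * ((1 - q) * F) * ((1 - q) * F))) * X
        = C * ((1 - k\<^sup>2 / q) * A) / (D * F)"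
    proof -
      define u v w where "u = 1 - q / k\<^sup>2" "v = 1 - k\<^sup>2 / q\<^sup>2" "w = 1 - q"
      have "v \<noteq> 0" "w \<noteq> 0" using f(4,5) by (simp_all add: u_v_w_def)
      then show ?thesis
        unfolding X_def f(1,2,3) u_v_w_def[symmetric] using nzA nz2(3,4)
        by (simp add: power2_eq_square mult_ac)
    qed
    also have "\<dots> = S * X" using eq' unfolding X_def by (simp only: mult.assoc)
    finally show ?thesis unfolding mult_right_cancel[OF X] .
  qed
  finally show ?thesis by (simp add: S_def)
qed

lemma column_sum_eq: "column_sum q k j = alpha_weight q k j"
proof -
  consider "j = 0" | n where "j = 2 * n + 2" | n where "j = 2 * n + 1"
  proof (cases "even j")
    case True
    then obtain m where "j = 2 * m" by blast
    then show ?thesis using that by (cases m) auto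
  qed (use that in \<open>auto elim!: oddE\<close>)
  then show ?thesis
  proof cases
    case 1
    then show ?thesis using column_sum_0 by (simp add: alpha_weight_def algebra_simps)
  next
    case 2
    then show ?thesis using column_sum_even by (simp add: alpha_weight_def)
  next
    case 3
    then show ?thesis using column_sum_odd column_sum_0 by (simp add: alpha_weight_def)
  qed
qed

end
end
end

section \<open>The inverse relation on the generic set\<close>

text \<open>The matrix with \<open>a = q\<close> and \<open>k\<close> exchanged, rescaled on both
  sides by diagonal matrices; \<open>(k / q) ^ (n - j)\<close> is part of that rescaling.\<close>

definition wp_matrix_inv :: "complex \<Rightarrow> complex \<Rightarrow> nat \<Rightarrow> nat \<Rightarrow> complex" where
  "wp_matrix_inv q k n j = (1 - q * q ^ (2 * n)) * (1 - k * q ^ (2 * j)) / ((1 - q) * (1 - k)) * (k / q) ^ (n - j) * wp_matrix q k q n j"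

text \<open>An admissible \<open>k\<close> outside this set has \<open>k^2 = q^(1-2l)\<close>, and
  then the factor \<open>(k^2/q;q)_n\<close> of \<open>beta_coeff\<close> vanishes for large
  \<open>n\<close>.\<close>

definition generic_set :: "complex \<Rightarrow> complex set" where
  "generic_set q = {k. k \<noteq> 0 \<and> (\<forall>m. k\<^sup>2 * q ^ m \<noteq> 1 \<and> k\<^sup>2 \<noteq> q ^ Suc m)}"

lemma wp_matrix_inv_gt [simp]: "n < j \<Longrightarrow> wp_matrix_inv q k n j = 0"
  by (simp add: wp_matrix_inv_def)

lemma zero_notin_generic_set [simp]: "0 \<notin> generic_set q"
  by (simp add: generic_set_def)

lemma generic_set_admissible: "k \<in> generic_set q \<Longrightarrow> admissible q k"
proof -
  assume k: "k \<in> generic_set q"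
  have "k\<^sup>2 \<noteq> q ^ (2 * m + 2)" "k\<^sup>2 \<noteq> q ^ (2 * m + 3)" for m
  proof -
    have "k\<^sup>2 \<noteq> q ^ Suc l" for l
      using k by (simp add: generic_set_def)
    from this[of "2 * m + 1"] this[of "2 * m + 2"]
    show "k\<^sup>2 \<noteq> q ^ (2 * m + 2)" "k\<^sup>2 \<noteq> q ^ (2 * m + 3)"
      by (simp_all add: numeral_3_eq_3)
  qed
  then show ?thesis using k by (simp add: generic_set_def admissible_def)
qed

context
  fixes q :: complex
  assumes q: "0 < norm q" "norm q < 1"
begin

lemma countable_non_generic: "countable (- generic_set q)"
proof -
  have "- generic_set q = {0} \<union> (\<Union>m. {k. k\<^sup>2 = 1 / q ^ m}) \<union> (\<Union>m. {k. k\<^sup>2 = q ^ Suc m})"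
    using q_nonzero[OF q] by (auto simp: generic_set_def field_simps)
  then show ?thesis
    by (simp add: countable_power2_eq del: power_Suc)
qed

text \<open>Deleting countably many points does not disconnect the plane.\<close>

lemma connected_generic_set: "connected (generic_set q)"
  using connected_open_diff_countable[OF _ open_UNIV connected_UNIV countable_non_generic] by (simp add: Diff_eq)

text \<open>The excluded values accumulate at \<open>0\<close>, so openness does not follow from
  countability. The set is the nonvanishing locus in the punctured plane of the theta function
  \<open>(k^2;q)_\<infinity> * (q/k^2;q)_\<infinity>\<close>.\<close>

lemma open_generic_set: "open (generic_set q)"
proof -
  define g where "g k = qpoch_inf (k\<^sup>2) q * qpoch_inf (q / k\<^sup>2) q" for k
  have "g holomorphic_on (- {0})"
    unfolding g_def by (intro holomorphic_intros holomorphic_qpoch_inf_compose q) auto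
  then have "open ((- {0}) \<inter> g -` (- {0}))"
    by (intro continuous_open_preimage holomorphic_on_imp_continuous_on) auto
  moreover have "(- {0}) \<inter> g -` (- {0}) = generic_set q"
  proof -
    have 1: "qpoch_inf (q / k\<^sup>2) q \<noteq> 0 \<longleftrightarrow> (\<forall>m. k\<^sup>2 \<noteq> q ^ Suc m)" if "k \<noteq> 0" for k
      using that by (auto simp: qpoch_inf_eq_0_iff q divide_eq_eq eq_commute[of "k\<^sup>2"])
    have 2: "qpoch_inf (k\<^sup>2) q \<noteq> 0 \<longleftrightarrow> (\<forall>m. k\<^sup>2 * q ^ m \<noteq> 1)" for k
      by (auto simp: qpoch_inf_eq_0_iff q)
    have "k \<in> (- {0}) \<inter> g -` (- {0}) \<longleftrightarrow> k \<in> generic_set q" for k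
      using 1[of k] 2[of k]
      by (cases "k = 0") (simp_all add: generic_set_def g_def all_conj_distrib del: power_Suc)
    then show ?thesis by blast
  qed
  ultimately show ?thesis by simp
qed

lemma generic_q_div_k_power_ne_1: "k \<in> generic_set q \<Longrightarrow> q / k * q ^ m \<noteq> 1"
  using k_power_ne[OF q generic_set_admissible, of k 0 "Suc m"] by (auto simp: generic_set_def divide_eq_eq)

lemma wp_matrix_wp_matrix_inv:
  assumes k: "k \<in> generic_set q" and "i \<le> n"
  shows "(\<Sum>j=i..n. wp_matrix q q k n j * wp_matrix_inv q k j i) = (if n = i then 1 else 0)"
proof -
  note adm = generic_set_admissible[OF k]
  define c where "c = (1 - k * q ^ (2 * i)) / ((1 - q) * (1 - k))"
  have nz: "1 - k * q ^ (2 * i) \<noteq> 0" "1 - q \<noteq> 0" "1 - k \<noteq> 0"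
    using k_power_ne_1[OF q adm, of "2 * i"] k_power_ne_1[OF q adm, of 0] q by auto
  have "(\<Sum>j=i..n. wp_matrix q q k n j * wp_matrix_inv q k j i)
     = c * (\<Sum>j=i..n. wp_matrix q q k n j * (1 - q * q ^ (2 * j)) * (k / q) ^ (j - i) * wp_matrix q k q j i)"
    unfolding sum_distrib_left by (intro sum.cong refl) (simp add: wp_matrix_inv_def c_def)
  also have "(\<Sum>j=i..n. wp_matrix q q k n j * (1 - q * q ^ (2 * j)) * (k / q) ^ (j - i) * wp_matrix q k q j i)
     = (if n = i then (1 - q) * (1 - k) / (1 - k * q ^ (2 * i)) else 0)"
    using q_power_ne_1[OF q, of "Suc _"]
    by (intro wp_matrix_orthogonal assms(2) q_nonzero[OF q] k_nonzero[OF q adm] k_power_ne_1[OF q adm]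
        k_div_q_power_ne_1[OF q adm]) simp_all
  finally show ?thesis using nz by (simp add: c_def)
qed

lemma wp_matrix_inv_wp_matrix:
  assumes k: "k \<in> generic_set q" and "i \<le> n"
  shows "(\<Sum>j=i..n. wp_matrix_inv q k n j * wp_matrix q q k j i) = (if n = i then 1 else 0)"
proof -
  note adm = generic_set_admissible[OF k]
  define c where "c = (1 - q * q ^ (2 * n)) / ((1 - q) * (1 - k)) * (k / q) ^ (n - i)"
  have nz: "1 - q * q ^ (2 * n) \<noteq> 0" "1 - q \<noteq> 0" "1 - k \<noteq> 0" "k \<noteq> 0" "q \<noteq> 0"
    using q_power_ne_1[OF q, of "Suc (2 * n)"] k_power_ne_1[OF q adm, of 0] q k_nonzero[OF q adm] by auto
  \<comment> \<open>The orthogonality relation with \<open>a\<close> and \<open>k\<close> exchanged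
    carries \<open>(q / k) ^ (j - i)\<close>; the complementary power is independent of
    \<open>j\<close> and goes into \<open>c\<close>.\<close>
  have pw: "(k / q) ^ (n - j) = (k / q) ^ (n - i) * (q / k) ^ (j - i)" if "i \<le> j" "j \<le> n" for j
  proof -
    have "n - i = (n - j) + (j - i)" using that by simp
    then have "(k / q) ^ (n - i) = (k / q) ^ (n - j) * (k / q) ^ (j - i)" by (simp only: power_add)
    then show ?thesis using nz by (simp add: power_divide)
  qed
  have "(\<Sum>j=i..n. wp_matrix_inv q k n j * wp_matrix q q k j i)
     = c * (\<Sum>j=i..n. wp_matrix q k q n j * (1 - k * q ^ (2 * j)) * (q / k) ^ (j - i) * wp_matrix q q k j i)"
    unfolding sum_distrib_left
  proof (intro sum.cong refl)
    fix j assume "j \<in> {i..n}"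
    then have j: "i \<le> j" "j \<le> n" by auto
    show "wp_matrix_inv q k n j * wp_matrix q q k j i
      = c * (wp_matrix q k q n j * (1 - k * q ^ (2 * j)) * (q / k) ^ (j - i) * wp_matrix q q k j i)"
      unfolding wp_matrix_inv_def c_def pw[OF j] by simp
  qed
  also have "(\<Sum>j=i..n. wp_matrix q k q n j * (1 - k * q ^ (2 * j)) * (q / k) ^ (j - i) * wp_matrix q q k j i)
     = (if n = i then (1 - k) * (1 - q) / (1 - q * q ^ (2 * i)) else 0)"
    using q_power_ne_1[OF q, of "Suc _"]
    by (intro wp_matrix_orthogonal assms(2) nz k_power_ne_1[OF q adm] generic_q_div_k_power_ne_1[OF k]) simp_all
  finally show ?thesis using nz by (auto simp: c_def)
qed

lemma inversion:
  assumes k: "k \<in> generic_set q" and \<beta>: "\<And>n. \<beta> n = (\<Sum>j\<le>n. wp_matrix q q k n j * \<alpha> j)"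
  shows "\<alpha> n = (\<Sum>j\<le>n. wp_matrix_inv q k n j * \<beta> j)"
proof -
  have "(\<Sum>j\<le>n. wp_matrix_inv q k n j * \<beta> j) = (\<Sum>j\<le>n. \<Sum>i\<le>j. wp_matrix_inv q k n j * wp_matrix q q k j i * \<alpha> i)"
    by (simp add: \<beta> sum_distrib_left mult.assoc)
  also have "\<dots> = (\<Sum>j\<le>n. \<Sum>i\<le>n. wp_matrix_inv q k n j * wp_matrix q q k j i * \<alpha> i)"
    by (intro sum.cong refl sum.mono_neutral_left) auto
  also have "\<dots> = (\<Sum>i\<le>n. \<Sum>j\<le>n. wp_matrix_inv q k n j * wp_matrix q q k j i * \<alpha> i)"
    by (rule sum.swap)
  also have "\<dots> = (\<Sum>i\<le>n. (\<Sum>j=i..n. wp_matrix_inv q k n j * wp_matrix q q k j i) * \<alpha> i)"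
    unfolding sum_distrib_right by (intro sum.cong refl sum.mono_neutral_right) auto
  also have "\<dots> = (\<Sum>i\<le>n. (if n = i then 1 else 0) * \<alpha> i)"
    using wp_matrix_inv_wp_matrix[OF k] by simp
  also have "\<dots> = (\<Sum>i\<le>n. if n = i then \<alpha> i else 0)" by (intro sum.cong refl) simp
  also have "\<dots> = \<alpha> n" by simp
  finally show ?thesis by simp
qed

section \<open>Holomorphy in \<open>k\<close> and bounds uniform on compact sets\<close>

lemma generic_nonzero:
  assumes "k \<in> generic_set q"
  shows "k \<noteq> 0" "1 - k \<noteq> 0" "k\<^sup>2 - q\<^sup>2 \<noteq> 0"
  using assms k_power_ne_1[OF q generic_set_admissible[OF assms], of 0]
proof -
  have "k\<^sup>2 \<noteq> q ^ Suc 1" using assms unfolding generic_set_def by blast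
  then show "k\<^sup>2 - q\<^sup>2 \<noteq> 0" by (simp add: power2_eq_square)
qed (use assms in \<open>auto simp: generic_set_def\<close>)

lemma holomorphic_theta_quot: "theta_quot q holomorphic_on generic_set q"
proof -
  have nz: "qpoch_inf (k\<^sup>2) (q\<^sup>2) \<noteq> 0" "qpoch_inf (q\<^sup>2 / k\<^sup>2) (q\<^sup>2) \<noteq> 0" "qpoch_inf q (q\<^sup>2) \<noteq> 0"
    if "k \<in> generic_set q" for k
    using k2_power_ne_1[OF q generic_set_admissible[OF that]] q2_div_k2_ne_1[OF q generic_set_admissible[OF that]]
      q_power_mult_ne_1[OF q generic_set_admissible[OF that], of 1] norm_q2[OF q]
    by (auto simp: qpoch_inf_eq_0_iff)
  show ?thesis
    unfolding theta_quot_def[abs_def] qpochs_inf_def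
    using nz generic_nonzero norm_q2[OF q]
    by (auto intro!: holomorphic_intros holomorphic_qpoch_inf_compose)
qed

lemma holomorphic_pole_term: "pole_term q holomorphic_on generic_set q"
  unfolding pole_term_def[abs_def] using generic_nonzero q by (intro holomorphic_intros) auto

lemma qpoch_generic_nonzero:
  assumes "k \<in> generic_set q"
  shows "qpoch (k * q) q n \<noteq> 0" "qpoch (q^2 / k) q n \<noteq> 0" "qpoch (k^2) (q^2) n \<noteq> 0"
    "qpoch (q^4 / k^2) (q^2) n \<noteq> 0" "qpoch (q^3 / k^2) (q^2) n \<noteq> 0" "qpoch (q^3) (q^2) n \<noteq> 0" "qpoch (q^2) (q^2) n \<noteq> 0"
    "qpoch q q n \<noteq> 0"
  using k_power_ne_1[OF q generic_set_admissible[OF assms], of "Suc _"] q2_div_k_power_ne_1[OF q generic_set_admissible[OF assms]]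
    k2_power_ne_1[OF q generic_set_admissible[OF assms]] q4_div_k2_ne_1[OF q generic_set_admissible[OF assms]]
    q3_div_k2_ne_1[OF q generic_set_admissible[OF assms]] q_power_mult_ne_1[OF q generic_set_admissible[OF assms], of 3]
    q_power_mult_ne_1[OF q generic_set_admissible[OF assms], of 2] q_power_ne_1[OF q, of "Suc _"]
  by (auto simp: qpoch_eq_0_iff mult.assoc)

lemma holomorphic_qpoch: "f holomorphic_on S \<Longrightarrow> (\<lambda>k. qpoch (f k) p n) holomorphic_on S"
  unfolding qpoch_def by (intro holomorphic_intros)

lemma holomorphic_alpha_weight: "(\<lambda>k. alpha_weight q k j) holomorphic_on generic_set q"
proof -
  have "(\<lambda>k. theta_quot q k - pole_term q k) holomorphic_on generic_set q"
    by (intro holomorphic_intros holomorphic_theta_quot holomorphic_pole_term)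
  moreover have "(\<lambda>k. even_coeff q k n * (- (q^2) / k) ^ j) holomorphic_on generic_set q" for n
    unfolding even_coeff_def using qpoch_generic_nonzero generic_nonzero
    by (intro holomorphic_intros holomorphic_qpoch) auto
  moreover have "(\<lambda>k. theta_quot q k * odd_coeff q k n * (- (q^2) / k) ^ Suc j) holomorphic_on generic_set q" for n
    unfolding odd_coeff_def using qpoch_generic_nonzero generic_nonzero q_nonzero[OF q]
    by (intro holomorphic_intros holomorphic_qpoch holomorphic_theta_quot) auto
  ultimately show ?thesis
    unfolding alpha_weight_def by (cases "j = 0"; cases "even j"; simp only: if_True if_False simp_thms)
qed

lemma holomorphic_wp_matrix_inv: "(\<lambda>k. wp_matrix_inv q k n j) holomorphic_on generic_set q"
proof -
  have "(\<lambda>k. if j \<le> n then qpoch (q / k) q (n - j) * qpoch q q (n + j) / (qpoch q q (n - j) * qpoch (k * q) q (n + j)) else 0)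
    holomorphic_on generic_set q"
    using qpoch_generic_nonzero generic_nonzero
    by (cases "j \<le> n") (auto intro!: holomorphic_intros holomorphic_qpoch)
  then show ?thesis
    unfolding wp_matrix_inv_def wp_matrix_def using generic_nonzero q_nonzero[OF q] q
    by (intro holomorphic_intros) auto
qed

lemma holomorphic_beta_weight: "(\<lambda>k. beta_weight q k n) holomorphic_on generic_set q"
proof (cases "n = 0")
  case False
  have "(\<lambda>k. beta_coeff q k n * (- (q^2) / k) ^ n) holomorphic_on generic_set q"
    unfolding beta_coeff_def using qpoch_generic_nonzero generic_nonzero q_nonzero[OF q]
    by (intro holomorphic_intros holomorphic_qpoch) auto
  with False show ?thesis by (simp add: beta_weight_def)
qed (simp add: beta_weight_def)

lemma alpha_weight_bound:
  assumes K: "compact K" "K \<subseteq> generic_set q"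
  shows "\<exists>C\<ge>0. \<forall>k\<in>K. \<forall>j. norm (alpha_weight q k j) \<le> C * norm (q\<^sup>2 / k) ^ j"
proof -
  have adm: "admissible q k" if "k \<in> K" for k using generic_set_admissible that K(2) by blast
  have k0: "k \<noteq> 0" if "k \<in> K" for k using k_nonzero[OF q adm[OF that]] .
  have cth: "continuous_on K (theta_quot q)" "continuous_on K (pole_term q)"
    using holomorphic_theta_quot holomorphic_pole_term K(2) holomorphic_on_imp_continuous_on continuous_on_subset by blast+
  \<comment> \<open>Indexing by pairs makes the bounds uniform in \<open>k\<close> and in the length
    at once. The Pochhammer parameters depend on the first component only, so their images are
    compact.\<close>
  let ?A = "K \<times> (UNIV :: nat set)"
  have cpt: "compact ((\<lambda>p. f (fst p)) ` ?A)" if "continuous_on K f" for f :: "complex \<Rightarrow> complex"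
  proof -
    have "(\<lambda>p. f (fst p)) ` ?A = f ` K" by force
    then show ?thesis using that K(1) compact_continuous_image by metis
  qed
  note bdd = compact_imp_bounded[OF cpt]
  have "bounded ((\<lambda>p. qpoch (q^2) (q^2) (snd p) * qpoch ((fst p)^2 / q) (q^2) (Suc (snd p))
     * (inverse (qpoch (q^4 / (fst p)^2) (q^2) (Suc (snd p))) * inverse (qpoch (q^3) (q^2) (Suc (snd p))))) ` ?A)"
    using k0 q4_div_k2_ne_1[OF q adm] q_power_mult_ne_1[OF q adm, of _ 3] norm_q2[OF q] q_nonzero[OF q]
    by (intro bounded_image_mult bounded_qpoch bounded_inverse_qpoch
         bdd[of "\<lambda>k. k^2 / q"] bdd[of "\<lambda>k. q^2"] cpt[of "\<lambda>k. q^4 / k^2"] cpt[of "\<lambda>k. q^3"])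
       (auto intro!: continuous_intros)
  then obtain C1 where C1: "\<And>k n. k \<in> K \<Longrightarrow> norm (even_coeff q k n) \<le> C1"
    unfolding bounded_iff even_coeff_def by (force simp: divide_inverse)
  have "bounded ((\<lambda>p. theta_quot q (fst p) * (qpoch ((fst p)^2 / q^2) (q^2) (Suc (snd p)) * qpoch (1 / q) (q^2) (Suc (snd p))
     * (inverse (qpoch (q^3 / (fst p)^2) (q^2) (Suc (snd p))) * inverse (qpoch (q^2) (q^2) (Suc (snd p))))) * (- (q^2) / fst p)) ` ?A)"
    using k0 q3_div_k2_ne_1[OF q adm] q_power_mult_ne_1[OF q adm, of _ 2] norm_q2[OF q] q_nonzero[OF q]
    by (intro bounded_image_mult bounded_qpoch bounded_inverse_qpoch bdd[OF cth(1)]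
         bdd[of "\<lambda>k. k^2 / q^2"] bdd[of "\<lambda>k. 1 / q"] cpt[of "\<lambda>k. q^3 / k^2"] cpt[of "\<lambda>k. q^2"] bdd[of "\<lambda>k. - (q^2) / k"])
       (auto intro!: continuous_intros)
  then obtain C2 where C2: "\<And>k n. k \<in> K \<Longrightarrow> norm (theta_quot q k * odd_coeff q k n * (- (q^2) / k)) \<le> C2"
    unfolding bounded_iff odd_coeff_def by (force simp: divide_inverse mult.assoc)
  have "bounded ((\<lambda>k. theta_quot q k - pole_term q k) ` K)"
    by (intro bounded_continuous_image K continuous_on_diff cth)
  then obtain C3 where C3: "\<And>k. k \<in> K \<Longrightarrow> norm (theta_quot q k - pole_term q k) \<le> C3"
    by (auto simp: bounded_iff)
  define C where "C = max 0 (max C1 (max C2 C3))"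
  have "norm (alpha_weight q k j) \<le> C * norm (q\<^sup>2 / k) ^ j" if k: "k \<in> K" for k j
  proof -
    have r: "norm ((- (q\<^sup>2) / k) ^ j) = norm (q\<^sup>2 / k) ^ j" by (simp add: norm_power norm_divide)
    consider "j = 0" | "j \<noteq> 0" "even j" | "odd j" by blast
    then show ?thesis
    proof cases
      case 1
      then show ?thesis using C3[OF k] by (simp add: alpha_weight_def C_def)
    next
      case 2
      then have "norm (alpha_weight q k j) = norm (even_coeff q k (j div 2 - 1)) * norm (q\<^sup>2 / k) ^ j"
        by (simp only: alpha_weight_def norm_mult r if_True if_False)
      also have "\<dots> \<le> C * norm (q\<^sup>2 / k) ^ j"
        using C1[OF k, of "j div 2 - 1"] by (intro mult_right_mono) (auto simp: C_def)
      finally show ?thesis .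
    next
      case 3
      then have "j \<noteq> 0" by (metis even_zero)
      \<comment> \<open>The odd weights carry the power \<open>Suc j\<close>; the surplus factor is
        bounded on \<open>K\<close> and was included in the bound \<open>C2\<close>.\<close>
      have "alpha_weight q k j = (theta_quot q k * odd_coeff q k (j div 2) * (- (q^2) / k)) * (- (q\<^sup>2) / k) ^ j"
        using 3 \<open>j \<noteq> 0\<close> by (simp add: alpha_weight_def)
      then have "norm (alpha_weight q k j) = norm (theta_quot q k * odd_coeff q k (j div 2) * (- (q^2) / k)) * norm (q\<^sup>2 / k) ^ j"
        by (simp only: norm_mult r)
      also have "\<dots> \<le> C * norm (q\<^sup>2 / k) ^ j"
        using C2[OF k, of "j div 2"] by (intro mult_right_mono) (auto simp: C_def)
      finally show ?thesis .
    qed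
  qed
  moreover have "C \<ge> 0" by (simp add: C_def)
  ultimately show ?thesis by blast
qed

lemma wp_matrix_inv_bound:
  assumes K: "compact K" "K \<subseteq> generic_set q"
  shows "\<exists>C\<ge>0. \<forall>k\<in>K. \<forall>n j. norm (wp_matrix_inv q k n j) \<le> C * norm (k / q) ^ (n - j)"
proof -
  have adm: "admissible q k" if "k \<in> K" for k using generic_set_admissible that K(2) by blast
  have k0: "k \<noteq> 0" if "k \<in> K" for k using k_nonzero[OF q adm[OF that]] .
  have k1: "1 - k \<noteq> 0" if "k \<in> K" for k using k_power_ne_1[OF q adm[OF that], of 0] by simp
  let ?A = "K \<times> (UNIV :: (nat \<times> nat) set)"
  have cpt: "compact ((\<lambda>p. f (fst p)) ` ?A)" if "continuous_on K f" for f :: "complex \<Rightarrow> complex"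
  proof -
    have "(\<lambda>p. f (fst p)) ` ?A = f ` K" by force
    then show ?thesis using that K(1) compact_continuous_image by metis
  qed
  note bdd = compact_imp_bounded[OF cpt]
  have pw: "bounded ((\<lambda>p. 1 - f (fst p) * q ^ (g (snd p))) ` ?A)" if f: "continuous_on K f" for f g
  proof -
    obtain B where B: "\<And>k. k \<in> K \<Longrightarrow> norm (f k) \<le> B"
      using bounded_continuous_image[OF K(1) f] by (auto simp: bounded_iff)
    have "norm (1 - f k * q ^ m) \<le> 1 + B" if "k \<in> K" for k m
    proof -
      have "0 \<le> B" by (rule order_trans[OF norm_ge_zero B[OF that]])
      then have "norm (f k * q ^ m) \<le> B * 1"
        unfolding norm_mult norm_power using B[OF that] q by (intro mult_mono power_le_one) simp_all
      then show ?thesis using norm_triangle_ineq4[of 1 "f k * q ^ m"] by simp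
    qed
    then show ?thesis by (auto simp: bounded_iff)
  qed
  have "bounded ((\<lambda>p. wp_matrix q (fst p) q (fst (snd p)) (snd (snd p))) ` ?A)"
    using k0 q_power_ne_1[OF q, of "Suc _"] k_power_ne_1[OF q adm, of _ "Suc _"]
    by (intro bounded_wp_matrix q bdd[of "\<lambda>k. q / k"] bdd[of "\<lambda>k. q"] cpt[of "\<lambda>k. k * q"])
       (auto intro!: continuous_intros simp: mult.assoc)
  then have "bounded ((\<lambda>p. (1 - q * q ^ (2 * fst (snd p))) * (1 - fst p * q ^ (2 * snd (snd p))) * inverse ((1 - q) * (1 - fst p))
     * wp_matrix q (fst p) q (fst (snd p)) (snd (snd p))) ` ?A)"
    using k1 q by (intro bounded_image_mult pw[of "\<lambda>k. q" "\<lambda>x. 2 * fst x"] pw[of "\<lambda>k. k" "\<lambda>x. 2 * snd x"] bdd[of "\<lambda>k. inverse ((1 - q) * (1 - k))"])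
      (auto intro!: continuous_intros)
  then obtain C where C: "\<And>k n j. k \<in> K \<Longrightarrow> norm ((1 - q * q ^ (2 * n)) * (1 - k * q ^ (2 * j)) * inverse ((1 - q) * (1 - k)) * wp_matrix q k q n j) \<le> C"
    unfolding bounded_iff by force
  have "norm (wp_matrix_inv q k n j) \<le> max 0 C * norm (k / q) ^ (n - j)" if "k \<in> K" for k n j
  proof -
    have "norm (wp_matrix_inv q k n j) = norm ((1 - q * q ^ (2 * n)) * (1 - k * q ^ (2 * j)) * inverse ((1 - q) * (1 - k)) * wp_matrix q k q n j) * norm (k / q) ^ (n - j)"
      unfolding wp_matrix_inv_def norm_power[symmetric] norm_mult[symmetric] by (simp only: divide_inverse mult_ac)
    also have "\<dots> \<le> max 0 C * norm (k / q) ^ (n - j)"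
      using C[OF that, of n j] by (intro mult_right_mono) auto
    finally show ?thesis .
  qed
  then show ?thesis by (intro exI[of _ "max 0 C"]) auto
qed

text \<open>The factors \<open>(q^2/k)^j\<close> and \<open>(k/q)^(j-i)\<close> multiply to
  \<open>(q/k)^i * q^j\<close>: the decay in \<open>j\<close> has ratio |q|, whatever
  \<open>k\<close> is.\<close>

lemma weighted_inv_bound:
  assumes K: "compact K" "K \<subseteq> generic_set q"
  shows "\<exists>C\<ge>0. \<forall>k\<in>K. \<forall>i j. norm (alpha_weight q k j * wp_matrix_inv q k j i) \<le> C * norm (q / k) ^ i * norm q ^ j"
proof -
  obtain A where A: "A \<ge> 0" "\<And>k j. k \<in> K \<Longrightarrow> norm (alpha_weight q k j) \<le> A * norm (q\<^sup>2 / k) ^ j"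
    using alpha_weight_bound[OF K] by blast
  obtain B where B: "B \<ge> 0" "\<And>k n j. k \<in> K \<Longrightarrow> norm (wp_matrix_inv q k n j) \<le> B * norm (k / q) ^ (n - j)"
    using wp_matrix_inv_bound[OF K] by blast
  have "norm (alpha_weight q k j * wp_matrix_inv q k j i) \<le> A * B * norm (q / k) ^ i * norm q ^ j" if k: "k \<in> K" for k i j
  proof (cases "i \<le> j")
    case True
    then obtain d where d: "j = i + d" by (metis le_Suc_ex)
    have k0: "k \<noteq> 0" using k_nonzero[OF q generic_set_admissible] k K(2) by blast
    have "norm (alpha_weight q k j * wp_matrix_inv q k j i) \<le> (A * norm (q\<^sup>2 / k) ^ j) * (B * norm (k / q) ^ (j - i))"
      unfolding norm_mult using A B k by (intro mult_mono) auto
    also have "\<dots> = A * B * (norm (q\<^sup>2 / k) ^ j * norm (k / q) ^ (j - i))"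
      by (simp only: mult_ac)
    also have "norm (q\<^sup>2 / k) ^ j * norm (k / q) ^ (j - i) = norm (q / k) ^ i * norm q ^ j"
    proof -
      have "(norm (q / k) * norm (k / q)) ^ d = 1"
        using k0 q by (simp add: norm_divide)
      moreover have "norm (q\<^sup>2 / k) = norm q * norm (q / k)"
        by (simp add: norm_divide norm_mult power2_eq_square)
      ultimately show ?thesis
        by (simp add: d power_add power_mult_distrib mult_ac)
    qed
    finally show ?thesis by (simp only: mult.assoc)
  qed (use A(1) B(1) in simp)
  then show ?thesis using A(1) B(1) by (intro exI[of _ "A * B"]) auto
qed

end

section \<open>The inverted relation for large \<open>k\<close> and its analytic
  continuation\<close>

context
  fixes q :: complex
  assumes q: "0 < norm q" "norm q < 1"
begin

lemma summable_weighted_inv: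
  assumes "k \<in> generic_set q"
  shows "summable (\<lambda>j. alpha_weight q k j * wp_matrix_inv q k j i)"
proof -
  obtain C where C: "\<And>j. norm (alpha_weight q k j * wp_matrix_inv q k j i) \<le> C * norm (q / k) ^ i * norm q ^ j"
    using weighted_inv_bound[OF q, of "{k}"] assms by auto
  show ?thesis
    by (rule summable_comparison_test'[where g = "\<lambda>j. C * norm (q / k) ^ i * norm q ^ j" and N = 0])
       (use C q in \<open>auto intro!: summable_mult summable_geometric\<close>)
qed

text \<open>A partial sum over \<open>j \<le> J\<close> may be exchanged with the column sums. Rows
  \<open>n \<le> J\<close> then see the full inverse matrix and contribute
  \<open>beta_weight q k i\<close> in total. Rows \<open>n > J\<close> contribute at most a constant
  times \<open>(J + 1) * (\<rho> * |k/q|)^J\<close>, and \<open>\<rho> * |k/q| = |q|\<close>. The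
  hypothesis |q| < |k| allows every power of |k/q| to be replaced by the
  \<open>J\<close>-th.\<close>

lemma weighted_inv_sum_large:
  assumes k: "k \<in> generic_set q" and kq: "norm q < norm k"
  shows "(\<Sum>j. alpha_weight q k j * wp_matrix_inv q k j i) = beta_weight q k i"
proof -
  note adm = generic_set_admissible[OF k]
  have k0: "k \<noteq> 0" by (rule k_nonzero[OF q adm])
  have "norm (q\<^sup>2) < norm q" using q by (simp add: power2_eq_square norm_mult)
  with kq have kq2: "norm (q\<^sup>2) < norm k" by simp
  define \<rho> where "\<rho> = norm (- (q\<^sup>2) / k)"
  have \<rho>: "0 \<le> \<rho>" "\<rho> < 1" using norm_r[OF q adm kq2] by (simp_all add: \<rho>_def)
  define S where "S J = (\<Sum>j\<le>J. alpha_weight q k j * wp_matrix_inv q k j i)" for J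
  obtain A where A: "\<And>n j. norm (bailey_term q k n j) \<le> A * \<rho> ^ n"
    using bailey_term_bound[OF q adm kq2] unfolding \<rho>_def by blast
  obtain B where B: "B \<ge> 0" "\<And>n j. norm (wp_matrix_inv q k n j) \<le> B * norm (k / q) ^ (n - j)"
    using wp_matrix_inv_bound[OF q, of "{k}"] k by auto
  have A0: "0 \<le> A" using order_trans[OF norm_ge_zero A[of 0 0]] by simp
  have kq1: "1 \<le> norm (k / q)" using kq q by (simp add: norm_divide)
  have main: "norm (S J - beta_weight q k i) \<le> A * B * (\<rho> / (1 - \<rho>)) * (real (Suc J) * norm q ^ J)" if "i \<le> J" for J
  proof -
    define h where "h n = (\<Sum>j\<le>J. bailey_term q k n j * wp_matrix_inv q k j i)" for n
    have sm: "summable h"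
      unfolding h_def by (intro summable_sum summable_mult2 summable_bailey_term[OF q adm kq2])
    have "S J = (\<Sum>j\<le>J. (\<Sum>n. bailey_term q k n j) * wp_matrix_inv q k j i)"
      unfolding S_def by (simp add: column_sum_eq[OF q adm kq2, symmetric] column_sum_def)
    also have "\<dots> = (\<Sum>j\<le>J. \<Sum>n. bailey_term q k n j * wp_matrix_inv q k j i)"
      by (intro sum.cong refl suminf_mult2 summable_bailey_term[OF q adm kq2])
    also have "\<dots> = suminf h"
      unfolding h_def by (intro suminf_sum[symmetric] summable_mult2 summable_bailey_term[OF q adm kq2])
    also have "\<dots> = (\<Sum>n. h (n + Suc J)) + (\<Sum>n<Suc J. h n)"
      by (rule suminf_split_initial_segment[OF sm])
    also have "(\<Sum>n<Suc J. h n) = (\<Sum>n<Suc J. if n = i then beta_weight q k i else 0)"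
    proof (intro sum.cong refl)
      fix n assume "n \<in> {..<Suc J}"
      then have n: "n \<le> J" by simp
      have "h n = beta_weight q k n * (\<Sum>j\<le>J. wp_matrix q q k n j * wp_matrix_inv q k j i)"
        by (simp add: h_def bailey_term_def sum_distrib_left mult.assoc)
      also have "(\<Sum>j\<le>J. wp_matrix q q k n j * wp_matrix_inv q k j i) = (\<Sum>j=i..n. wp_matrix q q k n j * wp_matrix_inv q k j i)"
        using n by (intro sum.mono_neutral_right) (auto simp: not_le)
      also have "\<dots> = (if n = i then 1 else 0)"
        using wp_matrix_wp_matrix_inv[OF q k, of i n] by (cases "i \<le> n") auto
      finally show "h n = (if n = i then beta_weight q k i else 0)" by auto
    qed
    also have "\<dots> = beta_weight q k i" using that by simp
    finally have diff: "S J - beta_weight q k i = (\<Sum>n. h (n + Suc J))" by simp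
    have hb: "norm (h (n + Suc J)) \<le> A * B * real (Suc J) * norm q ^ J * \<rho> * \<rho> ^ n" for n
    proof -
      have "norm (h (n + Suc J)) \<le> (\<Sum>j\<le>J. A * \<rho> ^ (n + Suc J) * (B * norm (k / q) ^ J))"
        unfolding h_def
      proof (intro sum_norm_le)
        fix j assume "j \<in> {..J}"
        then have "norm (k / q) ^ (j - i) \<le> norm (k / q) ^ J"
          by (intro power_increasing kq1) auto
        then have "norm (wp_matrix_inv q k j i) \<le> B * norm (k / q) ^ J"
          using B(2)[of j i] mult_left_mono[OF _ B(1)] order_trans by blast
        then show "norm (bailey_term q k (n + Suc J) j * wp_matrix_inv q k j i) \<le> A * \<rho> ^ (n + Suc J) * (B * norm (k / q) ^ J)"
          unfolding norm_mult using A[of "n + Suc J" j] A0 \<rho> by (intro mult_mono) auto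
      qed
      also have "\<dots> = A * B * real (Suc J) * (\<rho> * norm (k / q)) ^ J * \<rho> * \<rho> ^ n"
        by (simp add: power_add power_mult_distrib mult_ac)
      also have "\<rho> * norm (k / q) = norm q"
        using k0 q by (simp add: \<rho>_def norm_mult[symmetric] power2_eq_square)
      finally show ?thesis .
    qed
    have "norm (\<Sum>n. h (n + Suc J)) \<le> (\<Sum>n. A * B * real (Suc J) * norm q ^ J * \<rho> * \<rho> ^ n)"
      using \<rho> by (intro norm_suminf_le hb summable_mult summable_geometric) auto
    also have "\<dots> = A * B * real (Suc J) * norm q ^ J * \<rho> * (1 / (1 - \<rho>))"
      using \<rho> by (simp add: suminf_mult suminf_geometric)
    finally show ?thesis unfolding diff by (simp add: mult_ac)
  qed
  have "(\<lambda>J. real (Suc J) * norm q ^ J) \<longlonglongrightarrow> 0"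
    using tendsto_add[OF powser_times_n_limit_0[of "norm q"] LIMSEQ_realpow_zero[of "norm q"]] q
    by (simp add: algebra_simps)
  then have "(\<lambda>J. A * B * (\<rho> / (1 - \<rho>)) * (real (Suc J) * norm q ^ J)) \<longlonglongrightarrow> 0"
    by (rule tendsto_mult_right_zero)
  then have "(\<lambda>J. S J - beta_weight q k i) \<longlonglongrightarrow> 0"
    by (rule Lim_null_comparison[rotated]) (use main in \<open>auto simp: eventually_sequentially\<close>)
  then have "S \<longlonglongrightarrow> beta_weight q k i"
    by (simp add: LIM_zero_iff)
  moreover have "S \<longlonglongrightarrow> (\<Sum>j. alpha_weight q k j * wp_matrix_inv q k j i)"
    unfolding S_def by (rule summable_LIMSEQ'[OF summable_weighted_inv[OF k]])
  ultimately show ?thesis using LIMSEQ_unique by blast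
qed

text \<open>Locally uniform convergence: on a closed disc inside the generic set |q/k| is bounded,
  which leaves a majorant geometric in |q|.\<close>

lemma holomorphic_weighted_inv_sum:
  "(\<lambda>k. \<Sum>j. alpha_weight q k j * wp_matrix_inv q k j i) holomorphic_on generic_set q"
proof (rule holomorphic_uniform_sequence[OF open_generic_set[OF q]])
  show "(\<lambda>k. \<Sum>j<n. alpha_weight q k j * wp_matrix_inv q k j i) holomorphic_on generic_set q" for n
    by (intro holomorphic_intros holomorphic_alpha_weight[OF q] holomorphic_wp_matrix_inv[OF q])
next
  fix x assume "x \<in> generic_set q"
  then obtain d where d: "d > 0" "cball x d \<subseteq> generic_set q"
    using open_generic_set[OF q] open_contains_cball by blast
  obtain C where C: "C \<ge> 0" "\<And>k j. k \<in> cball x d \<Longrightarrow> norm (alpha_weight q k j * wp_matrix_inv q k j i) \<le> C * norm (q / k) ^ i * norm q ^ j"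
    using weighted_inv_bound[OF q compact_cball d(2)] by blast
  have "continuous_on (cball x d) (\<lambda>k. q / k)"
    using d(2) by (intro continuous_intros) (use zero_notin_generic_set in blast)
  then have "bounded ((\<lambda>k. q / k) ` cball x d)"
    by (rule bounded_continuous_image[OF compact_cball])
  then obtain B where B: "\<And>k. k \<in> cball x d \<Longrightarrow> norm (q / k) \<le> B"
    unfolding bounded_iff by blast
  have "uniform_limit (cball x d) (\<lambda>n k. \<Sum>j<n. alpha_weight q k j * wp_matrix_inv q k j i)
     (\<lambda>k. \<Sum>j. alpha_weight q k j * wp_matrix_inv q k j i) sequentially"
  proof (rule Weierstrass_m_test)
    show "norm (alpha_weight q k j * wp_matrix_inv q k j i) \<le> C * B ^ i * norm q ^ j" if "k \<in> cball x d" for k j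
    proof -
      have "norm (q / k) ^ i \<le> B ^ i" by (intro power_mono B that norm_ge_zero)
      then have "C * norm (q / k) ^ i * norm q ^ j \<le> C * B ^ i * norm q ^ j"
        by (intro mult_right_mono mult_left_mono C(1)) auto
      with C(2)[OF that] show ?thesis by (rule order_trans)
    qed
    show "summable (\<lambda>j. C * B ^ i * norm q ^ j)"
      using q by (intro summable_mult summable_geometric) auto
  qed
  with d show "\<exists>d>0. cball x d \<subseteq> generic_set q \<and> uniform_limit (cball x d) (\<lambda>n k. \<Sum>j<n. alpha_weight q k j * wp_matrix_inv q k j i)
     (\<lambda>k. \<Sum>j. alpha_weight q k j * wp_matrix_inv q k j i) sequentially"
    by blast
qed

lemma weighted_inv_sum:
  assumes "k \<in> generic_set q"
  shows "(\<Sum>j. alpha_weight q k j * wp_matrix_inv q k j i) = beta_weight q k i"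
proof (rule analytic_continuation_open[OF _ open_generic_set[OF q] _ connected_generic_set[OF q] _
    holomorphic_weighted_inv_sum holomorphic_beta_weight[OF q] _ assms])
  define U where "U = generic_set q \<inter> - cball 0 (norm q)"
  show "open U" unfolding U_def by (intro open_Int open_generic_set[OF q]) auto
  show "U \<subseteq> generic_set q" by (simp add: U_def)
  show "(\<Sum>j. alpha_weight q k j * wp_matrix_inv q k j i) = beta_weight q k i" if "k \<in> U" for k
    using that weighted_inv_sum_large by (simp add: U_def)
  show "U \<noteq> {}"
  proof
    assume "U = {}"
    \<comment> \<open>Every point of this disc has norm above \<open>1\<close>, hence above |q|. If
      \<open>U\<close> were empty, the disc would lie in the countable set of non-generic
      values.\<close>
    have "ball 2 1 \<subseteq> - generic_set q"
    proof
      fix x :: complex assume "x \<in> ball 2 1"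
      then have "norm x > 1" using norm_triangle_ineq2[of 2 "2 - x"] by (simp add: dist_norm)
      then have "x \<in> - cball 0 (norm q)" using q by simp
      with \<open>U = {}\<close> show "x \<in> - generic_set q" unfolding U_def by blast
    qed
    then have "countable (ball (2::complex) 1)"
      using countable_non_generic[OF q] countable_subset by blast
    then show False using uncountable_ball[of 1 "2::complex"] by simp
  qed
qed

section \<open>Comparison of the partial sums of both sides\<close>

lemma k2_div_q_power_ne_1:
  assumes "k \<in> generic_set q"
  shows "k\<^sup>2 / q * q ^ n \<noteq> 1"
proof (cases n)
  case 0
  have "k\<^sup>2 \<noteq> q ^ Suc 0" using assms unfolding generic_set_def by blast
  then show ?thesis using 0 q_nonzero[OF q] by simp
next
  case (Suc m)
  then show ?thesis using assms q_nonzero[OF q] by (simp add: generic_set_def)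
qed

lemma beta_coeff_nonzero:
  assumes "k \<in> generic_set q"
  shows "beta_coeff q k n \<noteq> 0"
  using qpoch_generic_nonzero[OF q assms] k2_div_q_power_ne_1[OF assms]
    k_power_ne_1[OF q generic_set_admissible[OF assms], of "2 * n"] k_power_ne_1[OF q generic_set_admissible[OF assms], of 0]
  by (simp add: beta_coeff_def qpoch_eq_0_iff[of "k\<^sup>2 / q"])

lemma bounded_inverse_beta_coeff:
  assumes k: "k \<in> generic_set q"
  shows "bounded (range (\<lambda>n. inverse (beta_coeff q k n)))"
proof -
  note adm = generic_set_admissible[OF k]
  \<comment> \<open>A quotient of Pochhammer symbols, so that the general bounds also cover the
    factor \<open>1 - k * q ^ (2 * n)\<close>.\<close>
  have 1: "inverse (1 - k * q ^ (2 * n)) = qpoch k q (2 * n) * inverse (qpoch k q (Suc (2 * n)))" for n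
    using k_power_ne_1[OF q adm] by (simp add: qpoch_Suc qpoch_eq_0_iff)
  have "inverse (beta_coeff q k n) = qpoch k q (2 * n) * inverse (qpoch k q (Suc (2 * n))) * inverse (qpoch q q (n - 1))
     * inverse (qpoch (k^2 / q) q n) * inverse (qpoch (q^2) (q^2) n)
     * ((1 - k) * (qpoch (q^2 / k) q n * qpoch (k * q) q n) * qpoch (k^2) (q^2) n)" for n
    unfolding 1[symmetric] beta_coeff_def by (simp add: divide_inverse mult_ac)
  moreover have "bounded (range (\<lambda>n. qpoch k q (2 * n) * inverse (qpoch k q (Suc (2 * n))) * inverse (qpoch q q (n - 1))
     * inverse (qpoch (k^2 / q) q n) * inverse (qpoch (q^2) (q^2) n)
     * ((1 - k) * (qpoch (q^2 / k) q n * qpoch (k * q) q n) * qpoch (k^2) (q^2) n)))"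
    using k_power_ne_1[OF q adm] q_power_ne_1[OF q, of "Suc _"] q_power_mult_ne_1[OF q adm, of 2] k2_div_q_power_ne_1[OF k]
    by (intro bounded_image_mult bounded_qpoch bounded_inverse_qpoch q norm_q2[OF q])
       (auto simp: image_constant_conv)
  ultimately show ?thesis by simp
qed

text \<open>After \<open>\<alpha>\<close> is expressed through \<open>\<beta>\<close>, the
  coefficient of \<open>\<beta> i\<close> in the difference is a tail of the inverted relation, and
  the bound becomes a convolution of the null sequence \<open>e\<close> with powers of |q|.\<close>

lemma weighted_difference_tendsto_generic:
  assumes k: "k \<in> generic_set q" and \<beta>: "\<And>n. \<beta> n = (\<Sum>j\<le>n. wp_matrix q q k n j * \<alpha> j)"
    and lim: "(\<lambda>n. beta_weight q k n * \<beta> n) \<longlonglongrightarrow> 0"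
  shows "(\<lambda>N. (\<Sum>j\<le>N. alpha_weight q k j * \<alpha> j) - (\<Sum>n\<le>N. beta_weight q k n * \<beta> n)) \<longlonglongrightarrow> 0"
proof -
  have k0: "k \<noteq> 0" by (rule k_nonzero[OF q generic_set_admissible[OF k]])
  define e where "e n = norm (\<beta> n) * norm (q\<^sup>2 / k) ^ n" for n
  have "e \<longlonglongrightarrow> 0"
  proof -
    obtain B where B: "\<And>n. norm (inverse (beta_coeff q k n)) \<le> B"
      using bounded_inverse_beta_coeff[OF k] by (auto simp: bounded_iff)
    have ev: "eventually (\<lambda>n. norm (e n) \<le> B * norm (beta_weight q k n * \<beta> n)) sequentially"
      using eventually_gt_at_top[of 0]
    proof eventually_elim
      case (elim n)
      have "\<beta> n * (- (q\<^sup>2) / k) ^ n = inverse (beta_coeff q k n) * (beta_weight q k n * \<beta> n)"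
        using elim beta_coeff_nonzero[OF k, of n] by (simp add: beta_weight_def)
      then have "e n = norm (inverse (beta_coeff q k n)) * norm (beta_weight q k n * \<beta> n)"
        unfolding e_def by (metis norm_divide norm_minus_cancel norm_mult norm_power)
      then show ?case using B[of n] by (simp add: e_def mult_right_mono)
    qed
    have "(\<lambda>n. B * norm (beta_weight q k n * \<beta> n)) \<longlonglongrightarrow> 0"
      using tendsto_mult_right_zero[OF tendsto_norm_zero[OF lim]] .
    with ev show ?thesis by (rule Lim_null_comparison)
  qed
  obtain C where C: "C \<ge> 0" "\<And>i j. norm (alpha_weight q k j * wp_matrix_inv q k j i) \<le> C * norm (q / k) ^ i * norm q ^ j"
    using weighted_inv_bound[OF q, of "{k}"] k by auto
  define c where "c = C * (norm q / (1 - norm q))"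
  have main: "norm ((\<Sum>j\<le>N. alpha_weight q k j * \<alpha> j) - (\<Sum>n\<le>N. beta_weight q k n * \<beta> n))
     \<le> c * (\<Sum>i\<le>N. e i * norm q ^ (N - i))" for N
  proof -
    have "(\<Sum>j\<le>N. alpha_weight q k j * \<alpha> j) = (\<Sum>j\<le>N. \<Sum>i\<le>j. alpha_weight q k j * wp_matrix_inv q k j i * \<beta> i)"
      by (simp add: inversion[OF q k \<beta>] sum_distrib_left mult.assoc)
    also have "\<dots> = (\<Sum>j\<le>N. \<Sum>i\<le>N. alpha_weight q k j * wp_matrix_inv q k j i * \<beta> i)"
      by (intro sum.cong refl sum.mono_neutral_left) auto
    also have "\<dots> = (\<Sum>i\<le>N. (\<Sum>j\<le>N. alpha_weight q k j * wp_matrix_inv q k j i) * \<beta> i)"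
      by (subst sum.swap) (simp add: sum_distrib_right)
    also have "\<dots> - (\<Sum>n\<le>N. beta_weight q k n * \<beta> n)
      = (\<Sum>i\<le>N. ((\<Sum>j\<le>N. alpha_weight q k j * wp_matrix_inv q k j i) - beta_weight q k i) * \<beta> i)"
      by (simp add: sum_subtractf left_diff_distrib)
    finally have eq: "(\<Sum>j\<le>N. alpha_weight q k j * \<alpha> j) - (\<Sum>n\<le>N. beta_weight q k n * \<beta> n)
      = (\<Sum>i\<le>N. ((\<Sum>j\<le>N. alpha_weight q k j * wp_matrix_inv q k j i) - beta_weight q k i) * \<beta> i)" .
    have "norm (((\<Sum>j\<le>N. alpha_weight q k j * wp_matrix_inv q k j i) - beta_weight q k i) * \<beta> i) \<le> c * (e i * norm q ^ (N - i))"
      if "i \<le> N" for i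
    proof -
      \<comment> \<open>The full series over \<open>j\<close> equals
        \<open>beta_weight q k i\<close>, so minus the tail from \<open>j = N + 1\<close>
        remains.\<close>
      have "(\<Sum>j\<le>N. alpha_weight q k j * wp_matrix_inv q k j i) - beta_weight q k i = - (\<Sum>j. alpha_weight q k (j + Suc N) * wp_matrix_inv q k (j + Suc N) i)"
        using suminf_split_initial_segment[OF summable_weighted_inv[OF k], of i "Suc N"] weighted_inv_sum[OF k, of i]
        by (simp add: lessThan_Suc_atMost)
      then have "norm ((\<Sum>j\<le>N. alpha_weight q k j * wp_matrix_inv q k j i) - beta_weight q k i)
        = norm (\<Sum>j. alpha_weight q k (j + Suc N) * wp_matrix_inv q k (j + Suc N) i)" by simp
      also have "\<dots> \<le> (\<Sum>j. C * norm (q / k) ^ i * norm q ^ Suc N * norm q ^ j)"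
      proof (rule norm_suminf_le)
        show "norm (alpha_weight q k (j + Suc N) * wp_matrix_inv q k (j + Suc N) i) \<le> C * norm (q / k) ^ i * norm q ^ Suc N * norm q ^ j" for j
          using C(2)[of "j + Suc N" i] by (simp add: power_add mult_ac)
        show "summable (\<lambda>j. C * norm (q / k) ^ i * norm q ^ Suc N * norm q ^ j)"
          using q by (intro summable_mult summable_geometric) auto
      qed
      also have "\<dots> = C * norm (q / k) ^ i * norm q ^ Suc N * (1 / (1 - norm q))"
        using q by (simp add: suminf_mult suminf_geometric)
      also have "\<dots> = c * (norm (q\<^sup>2 / k) ^ i * norm q ^ (N - i))"
      proof -
        obtain m where m: "N = i + m" using le_Suc_ex[OF \<open>i \<le> N\<close>] by auto
        have "norm (q\<^sup>2 / k) = norm (q / k) * norm q" by (simp add: norm_divide norm_mult power2_eq_square)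
        then show ?thesis by (simp add: c_def m power_add power_mult_distrib mult_ac)
      qed
      finally have "norm ((\<Sum>j\<le>N. alpha_weight q k j * wp_matrix_inv q k j i) - beta_weight q k i) * norm (\<beta> i)
          \<le> c * (norm (q\<^sup>2 / k) ^ i * norm q ^ (N - i)) * norm (\<beta> i)"
        by (rule mult_right_mono) simp
      then show ?thesis
        unfolding norm_mult e_def by (simp only: mult_ac)
    qed
    then show ?thesis
      unfolding eq sum_distrib_left by (intro sum_norm_le) simp
  qed
  have "(\<lambda>N. c * (\<Sum>i\<le>N. e i * norm q ^ (N - i))) \<longlonglongrightarrow> 0"
    using q by (intro tendsto_mult_right_zero tendsto_0_geometric_convolution \<open>e \<longlonglongrightarrow> 0\<close>) auto
  then show ?thesis
    by (rule Lim_null_comparison[rotated]) (use main in simp)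
qed

text \<open>Every \<open>beta_weight\<close> beyond \<open>m\<close> vanishes, so the column sums
  are finite and, once \<open>N \<ge> m\<close>, exchanging two finite sums shows that the
  difference is exactly \<open>0\<close>.\<close>

lemma weighted_difference_tendsto_degenerate:
  assumes adm: "admissible q k" and kq: "norm (q\<^sup>2) < norm k" and zero: "k\<^sup>2 / q * q ^ m = 1"
    and \<beta>: "\<And>n. \<beta> n = (\<Sum>j\<le>n. wp_matrix q q k n j * \<alpha> j)"
  shows "(\<lambda>N. (\<Sum>j\<le>N. alpha_weight q k j * \<alpha> j) - (\<Sum>n\<le>N. beta_weight q k n * \<beta> n)) \<longlonglongrightarrow> 0"
proof -
  have z: "beta_weight q k n = 0" if "n > m" for n
  proof -
    have "qpoch (k\<^sup>2 / q) q n = 0" using zero that by (auto simp: qpoch_eq_0_iff)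
    then show ?thesis by (simp add: beta_weight_def beta_coeff_def)
  qed
  have "(\<Sum>j\<le>N. alpha_weight q k j * \<alpha> j) = (\<Sum>n\<le>N. beta_weight q k n * \<beta> n)" if "m \<le> N" for N
  proof -
    have "alpha_weight q k j = (\<Sum>n\<le>N. bailey_term q k n j)" for j
      unfolding column_sum_eq[OF q adm kq, symmetric] column_sum_def
      by (rule suminf_finite) (use z that in \<open>auto simp: bailey_term_def\<close>)
    then have "(\<Sum>j\<le>N. alpha_weight q k j * \<alpha> j) = (\<Sum>j\<le>N. \<Sum>n\<le>N. bailey_term q k n j * \<alpha> j)"
      by (simp add: sum_distrib_right)
    also have "\<dots> = (\<Sum>n\<le>N. \<Sum>j\<le>N. bailey_term q k n j * \<alpha> j)"
      by (rule sum.swap)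
    also have "\<dots> = (\<Sum>n\<le>N. \<Sum>j\<le>n. bailey_term q k n j * \<alpha> j)"
      by (intro sum.cong refl sum.mono_neutral_right) (auto simp: bailey_term_def)
    also have "\<dots> = (\<Sum>n\<le>N. beta_weight q k n * \<beta> n)"
      by (simp add: \<beta> bailey_term_def sum_distrib_left mult.assoc)
    finally show ?thesis .
  qed
  then have "eventually (\<lambda>N. (\<Sum>j\<le>N. alpha_weight q k j * \<alpha> j) - (\<Sum>n\<le>N. beta_weight q k n * \<beta> n) = 0) sequentially"
    unfolding eventually_sequentially by auto
  then show ?thesis by (rule tendsto_eventually)
qed

lemma admissible_cases:
  assumes adm: "admissible q k"
  obtains "k \<in> generic_set q" | m where "norm (q\<^sup>2) < norm k" "k\<^sup>2 / q * q ^ m = 1"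
proof (cases "k \<in> generic_set q")
  case False
  have q2: "norm q ^ 4 < norm q"
    using power_strict_decreasing[of 1 4 "norm q"] q by simp
  have less: "norm (q\<^sup>2) < norm k" if "norm q \<le> norm (k\<^sup>2)"
  proof (rule power2_less_imp_less)
    show "(norm (q\<^sup>2))\<^sup>2 < (norm k)\<^sup>2"
      using q2 that by (simp add: norm_power power_mult[symmetric])
  qed simp
  from False consider m where "k\<^sup>2 * q ^ m = 1" | m where "k\<^sup>2 = q ^ Suc m"
    using k_nonzero[OF q adm] by (auto simp: generic_set_def)
  then show ?thesis
  proof cases
    case 1
    have "norm (k\<^sup>2) * norm q ^ m = 1" using 1 by (metis norm_mult norm_one norm_power)
    moreover have "norm q ^ m \<le> 1" using q by (intro power_le_one) auto
    ultimately have "norm (k\<^sup>2) \<ge> 1"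
      using mult_left_mono[of "norm q ^ m" 1 "norm (k\<^sup>2)"] by simp
    then have "norm (q\<^sup>2) < norm k" using less q by simp
    moreover have "k\<^sup>2 / q * q ^ Suc m = 1" using 1 q_nonzero[OF q] by simp
    ultimately show ?thesis using that(2) by blast
  next
    case 2
    have "m = 0"
    proof (rule ccontr)
      assume "m \<noteq> 0"
      then obtain l where "m = Suc l" using not0_implies_Suc by blast
      then show False using 2 k2_ne_power[OF q adm, of l] by simp
    qed
    then have k2: "k\<^sup>2 = q" using 2 by simp
    then have "k\<^sup>2 / q * q ^ 0 = 1" using q_nonzero[OF q] by simp
    moreover have "norm (q\<^sup>2) < norm k" using less k2 by simp
    ultimately show ?thesis using that(2) by blast
  qed
qed (use that in blast)

end

theorem corollary2:
  fixes q k :: complex and \<alpha> \<beta> :: "nat \<Rightarrow> complex"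
  assumes q: "0 < norm q" "norm q < 1"
    and k: "k \<noteq> 0"
    and pair: "WP_Bailey_pair q k q \<alpha> \<beta>"
    and denom_const: "(1 - k) * (1 - q) * (k^2 - q^2) \<noteq> 0"
    and denom_beta:
      "\<And>n. (1 - k) * qpochs [q^2 / k, k * q] q (Suc n) * qpoch (k^2) (q^2) (Suc n) \<noteq> 0"
    and denom_even: "\<And>n. qpochs [q^4 / k^2, q^3] (q^2) (Suc n) * k ^ (2 * Suc n) \<noteq> 0"
    and denom_odd: "\<And>n. qpochs [q^3 / k^2, q^2] (q^2) (n + 1) * k ^ (2 * n + 2) \<noteq> 0"
    and denom_inf: "qpochs_inf [k^2, q^2 / k^2, q, q] (q^2) \<noteq> 0"
    and summable_beta: "summable (\<lambda>n.
        (1 - k * q ^ (2 * Suc n)) * qpoch q q n * qpoch (k^2 / q) q (Suc n)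
          * qpoch (q^2) (q^2) (Suc n)
        / ((1 - k) * qpochs [q^2 / k, k * q] q (Suc n) * qpoch (k^2) (q^2) (Suc n))
        * (- (q^2) / k) ^ Suc n * \<beta> (Suc n))"
    and summable_even: "summable (\<lambda>n.
        qpoch (q^2) (q^2) n * qpoch (k^2 / q) (q^2) (Suc n) * q ^ (4 * Suc n) * \<alpha> (2 * Suc n)
        / (qpochs [q^4 / k^2, q^3] (q^2) (Suc n) * k ^ (2 * Suc n)))"
    and summable_odd: "summable (\<lambda>n.
        qpochs [k^2 / q^2, 1 / q] (q^2) (n + 1) * q ^ (4 * n + 4) * \<alpha> (2 * n + 1)
        / (qpochs [q^3 / k^2, q^2] (q^2) (n + 1) * k ^ (2 * n + 2)))"
  shows
    "(\<Sum>n.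
        (1 - k * q ^ (2 * Suc n)) * qpoch q q n * qpoch (k^2 / q) q (Suc n)
          * qpoch (q^2) (q^2) (Suc n)
        / ((1 - k) * qpochs [q^2 / k, k * q] q (Suc n) * qpoch (k^2) (q^2) (Suc n))
        * (- (q^2) / k) ^ Suc n * \<beta> (Suc n))
     - (\<Sum>n.
        qpoch (q^2) (q^2) n * qpoch (k^2 / q) (q^2) (Suc n) * q ^ (4 * Suc n) * \<alpha> (2 * Suc n)
        / (qpochs [q^4 / k^2, q^3] (q^2) (Suc n) * k ^ (2 * Suc n)))
     + (k^2 - q) * (k - q^2) / ((1 - k) * (1 - q) * (k^2 - q^2))
     = k * (qpochs_inf [k^2 * q, q / k^2, q^2, q^2] (q^2)
            / qpochs_inf [k^2, q^2 / k^2, q, q] (q^2))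
       * (1 + (\<Sum>n.
           qpochs [k^2 / q^2, 1 / q] (q^2) (n + 1) * q ^ (4 * n + 4) * \<alpha> (2 * n + 1)
           / (qpochs [q^3 / k^2, q^2] (q^2) (n + 1) * k ^ (2 * n + 2))))"
proof -
  define b e d where
    "b n = (1 - k * q ^ (2 * Suc n)) * qpoch q q n * qpoch (k^2 / q) q (Suc n)
          * qpoch (q^2) (q^2) (Suc n)
        / ((1 - k) * qpochs [q^2 / k, k * q] q (Suc n) * qpoch (k^2) (q^2) (Suc n))
        * (- (q^2) / k) ^ Suc n * \<beta> (Suc n)"
    and "e n = qpoch (q^2) (q^2) n * qpoch (k^2 / q) (q^2) (Suc n) * q ^ (4 * Suc n) * \<alpha> (2 * Suc n)
        / (qpochs [q^4 / k^2, q^3] (q^2) (Suc n) * k ^ (2 * Suc n))"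
    and "d n = qpochs [k^2 / q^2, 1 / q] (q^2) (n + 1) * q ^ (4 * n + 4) * \<alpha> (2 * n + 1)
           / (qpochs [q^3 / k^2, q^2] (q^2) (n + 1) * k ^ (2 * n + 2))" for n
  have q0: "q \<noteq> 0" using q by auto
  have adm: "admissible q k"
  proof -
    have 1: "k\<^sup>2 * q ^ (2 * m) \<noteq> 1" for m
      using denom_beta[of m] by (auto simp: qpoch_eq_0_iff power_mult)
    have 2: "k\<^sup>2 \<noteq> q ^ (2 * m + 2)" for m
    \<comment> \<open>The value \<open>k^2 = q^2\<close> is excluded by the denominator of the
      constant term, the higher even powers by the even series.\<close>
    proof (cases m)
      case 0
      then show ?thesis using denom_const by (simp add: power2_eq_square)
    next
      case (Suc l)
      have "q ^ 4 / k\<^sup>2 * (q\<^sup>2) ^ l \<noteq> 1"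
        using denom_even[of l] by (auto simp: qpochs_def qpoch_eq_0_iff)
      moreover have "q ^ (2 * m + 2) = q ^ 4 * (q\<^sup>2) ^ l"
        unfolding Suc power_mult[symmetric] power_add[symmetric] by (rule arg_cong[where f = "(^) q"]) simp
      ultimately show ?thesis using k by auto
    qed
    have 3: "k\<^sup>2 \<noteq> q ^ (2 * m + 3)" for m
    proof -
      have "q ^ 3 / k\<^sup>2 * (q\<^sup>2) ^ m \<noteq> 1"
        using denom_odd[of m] by (auto simp: qpochs_def qpoch_eq_0_iff)
      moreover have "q ^ (2 * m + 3) = q ^ 3 * (q\<^sup>2) ^ m"
        unfolding power_mult[symmetric] power_add[symmetric] by (rule arg_cong[where f = "(^) q"]) simp
      ultimately show ?thesis using k by auto
    qed
    show ?thesis using k 1 2 3 by (simp add: admissible_def)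
  qed
  \<comment> \<open>The pair relation is given for \<open>n > 0\<close> only. At
    \<open>n = 0\<close> it holds because the matrix entry is \<open>1\<close> and
    \<open>\<alpha> 0 = \<beta> 0 = 1\<close>.\<close>
  have \<beta>: "\<beta> n = (\<Sum>j\<le>n. wp_matrix q q k n j * \<alpha> j)" for n
    using pair by (cases "n = 0") (auto simp: WP_Bailey_pair_def wp_matrix_def atMost_atLeast0 intro!: sum.cong)
  have b: "beta_weight q k (Suc n) * \<beta> (Suc n) = b n" for n
    by (simp add: b_def beta_weight_def beta_coeff_def qpochs_def)
  have r: "(- (q^2) / k) ^ (2 * Suc n) = q ^ (4 * Suc n) / k ^ (2 * Suc n)" for n
  proof -
    have "(- (q^2) / k) ^ (2 * Suc n) = ((- (q^2) / k)\<^sup>2) ^ Suc n" by (simp only: power_mult)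
    also have "(- (q^2) / k)\<^sup>2 = q ^ 4 / k\<^sup>2" by (simp add: power_divide)
    finally show ?thesis by (simp only: power_divide power_mult)
  qed
  have e: "alpha_weight q k (2 * n + 2) * \<alpha> (2 * n + 2) = e n" for n
    using r[of n] by (simp add: e_def alpha_weight_def even_coeff_def qpochs_def)
  have d: "alpha_weight q k (2 * n + 1) * \<alpha> (2 * n + 1) = theta_quot q k * d n" for n
    using r[of n] by (simp add: d_def alpha_weight_def odd_coeff_def qpochs_def add.commute[of 4])
  have sb: "summable b" and se: "summable e" and sd: "summable d"
    using summable_beta summable_even summable_odd by (simp_all only: b_def[abs_def] e_def[abs_def] d_def[abs_def])
  have lim: "(\<lambda>n. beta_weight q k n * \<beta> n) \<longlonglongrightarrow> 0"
  proof -
    have "(\<lambda>n. beta_weight q k (Suc n) * \<beta> (Suc n)) \<longlonglongrightarrow> 0"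
      unfolding b by (rule summable_LIMSEQ_zero[OF sb])
    then show ?thesis by (simp only: filterlim_sequentially_Suc[of "\<lambda>n. beta_weight q k n * \<beta> n"])
  qed
  have "(\<lambda>N. (\<Sum>j\<le>N. alpha_weight q k j * \<alpha> j) - (\<Sum>n\<le>N. beta_weight q k n * \<beta> n)) \<longlonglongrightarrow> 0"
    using admissible_cases[OF q adm]
  proof cases
    case 1
    then show ?thesis by (rule weighted_difference_tendsto_generic[OF q _ \<beta> lim])
  next
    case (2 m)
    then show ?thesis by (rule weighted_difference_tendsto_degenerate[OF q adm _ _ \<beta>])
  qed
  \<comment> \<open>Even and odd \<open>\<alpha>\<close> form separate convergent series. Stopping
    at \<open>2 * m + 1\<close> gives the constant from \<open>\<alpha> 0\<close>, then
    \<open>m\<close> even and \<open>m + 1\<close> odd terms.\<close>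
  from LIMSEQ_subseq_LIMSEQ[OF this, of "\<lambda>m. 2 * m + 1"]
  have "(\<lambda>m. (\<Sum>j\<le>2 * m + 1. alpha_weight q k j * \<alpha> j) - (\<Sum>n\<le>2 * m + 1. beta_weight q k n * \<beta> n)) \<longlonglongrightarrow> 0"
    by (simp add: strict_mono_def o_def)
  moreover have "(\<Sum>n\<le>2 * m + 1. beta_weight q k n * \<beta> n) = (\<Sum>n<2 * m + 1. b n)" for m
    unfolding lessThan_Suc_atMost[symmetric] sum.lessThan_Suc_shift b by (simp add: beta_weight_def)
  moreover have "(\<Sum>j\<le>2 * m + 1. alpha_weight q k j * \<alpha> j)
     = (theta_quot q k - pole_term q k) + (\<Sum>n<m. e n) + theta_quot q k * (\<Sum>n<Suc m. d n)" for m
  proof (induction m)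
    case 0
    have "\<alpha> 0 = 1" using pair by (simp add: WP_Bailey_pair_def)
    then show ?case using d[of 0] by (simp add: alpha_weight_def)
  next
    case (Suc m)
    have "(\<Sum>j\<le>2 * Suc m + 1. alpha_weight q k j * \<alpha> j) = (\<Sum>j\<le>2 * m + 1. alpha_weight q k j * \<alpha> j)
        + alpha_weight q k (2 * m + 2) * \<alpha> (2 * m + 2) + alpha_weight q k (2 * Suc m + 1) * \<alpha> (2 * Suc m + 1)"
      by simp
    then show ?case unfolding Suc e d by (simp add: algebra_simps)
  qed
  ultimately have "(\<lambda>m. (theta_quot q k - pole_term q k) + (\<Sum>n<m. e n) + theta_quot q k * (\<Sum>n<Suc m. d n)
      - (\<Sum>n<2 * m + 1. b n)) \<longlonglongrightarrow> 0" by simp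
  moreover have "(\<lambda>m. (theta_quot q k - pole_term q k) + (\<Sum>n<m. e n) + theta_quot q k * (\<Sum>n<Suc m. d n)
      - (\<Sum>n<2 * m + 1. b n))
    \<longlonglongrightarrow> (theta_quot q k - pole_term q k) + suminf e + theta_quot q k * suminf d - suminf b"
  proof (intro tendsto_diff tendsto_add tendsto_mult tendsto_const)
    show "(\<lambda>m. \<Sum>n<m. e n) \<longlonglongrightarrow> suminf e" by (rule summable_LIMSEQ[OF se])
    show "(\<lambda>m. \<Sum>n<Suc m. d n) \<longlonglongrightarrow> suminf d"
      using LIMSEQ_Suc[OF summable_LIMSEQ[OF sd]] .
    show "(\<lambda>m. \<Sum>n<2 * m + 1. b n) \<longlonglongrightarrow> suminf b"
      using LIMSEQ_subseq_LIMSEQ[OF summable_LIMSEQ[OF sb], of "\<lambda>m. 2 * m + 1"]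
      by (simp add: strict_mono_def o_def)
  qed
  ultimately have "(theta_quot q k - pole_term q k) + suminf e + theta_quot q k * suminf d - suminf b = 0"
    using LIMSEQ_unique by blast
  then have "suminf b - suminf e + pole_term q k = theta_quot q k * (1 + suminf d)"
    by (simp add: algebra_simps)
  then show ?thesis
    unfolding b_def e_def d_def pole_term_def theta_quot_def .
qed

end
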